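(* Let $1<p<\infty$ and let $X$ be a Banach space for which there is a sequence of compact operators $K_n\in K(X)$ satisfying (a) $K_n x\to x$ in norm for all $x\in X$, (b) $K_n^* x^*\to x^*$ in norm for all $x^*\in X^*$, (c) $\|\mathrm{Id}_X-2K_n\|\to 1$. Suppose that $$\limsup_n \bigl(\|x\|^{p}+\|x_n\|^{p}\bigr)^{1/p}\le \limsup_n\left(\frac{\|x+x_n\|^{p}+\|x-x_n\|^{p}}{2}\right)^{1/p}$$ for all $x\in X$ and all sequences $(x_n)$ in $X$ such that $x_n\to 0$ weakly. Then $K(X,\ell_p)$ is an $M$-ideal in $L(X,\ell_p)$.
   Context: For Banach spaces $X,Y$, $L(X,Y)$ denotes the Banach space of bounded linear operators from $X$ to $Y$ with the operator norm, $K(X,Y)$ its closed subspace of compact operators, and $K(X)=K(X,X)$. A closed subspace $J$ of a Banach space $E$ is called an $M$-ideal in $E$ if there is a closed subspace $V$ of $E^*$ such that $E^*=J^\perp\oplus_1 V$, where $J^\perp=\{e^*\in E^*: e^*|_J=0\}$ and $\oplus_1$ means that $E^*$ is the direct sum of $J^\perp$ and $V$ with $\|u+v\|=\|u\|+\|v\|$ for all $u\in J^\perp$, $v\in V$. *)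

theory Defs
  imports "HOL-Analysis.Analysis" "HOL-Library.Function_Algebras"
begin

text \<open>
  Banach spaces over \<open>\<real>\<close> or \<open>\<complex>\<close>. The sort of \<open>'k\<close> covers exactly these two
  scalar fields: its norm is multiplicative, so up to isometric isomorphism \<open>real\<close> and \<open>complex\<close>
  are its only instances. Class \<^class>\<open>banach\<close> supplies the complete norm and the underlying real
  structure, and the locale adds the multiplication by scalars from \<open>'k\<close>.
\<close>

locale banach_over = vector_space scale
  for scale :: "'k::{real_normed_field,euclidean_space} \<Rightarrow> 'a::banach \<Rightarrow> 'a" +
  assumes norm_scale: "norm (scale c x) = norm c * norm x"
    and scale_of_real: "scale (of_real r) x = r *\<^sub>R x"

lemma banach_over_real: "banach_over (scaleR :: real \<Rightarrow> 'a::banach \<Rightarrow> 'a)"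
  by unfold_locales (simp_all add: scaleR_add_right scaleR_add_left)

lemma banach_over_complex: "banach_over ((*) :: complex \<Rightarrow> complex \<Rightarrow> complex)"
  by unfold_locales (simp_all add: algebra_simps norm_mult scaleR_conv_of_real)

definition linear_ops ::
  "('k::{real_normed_field,euclidean_space} \<Rightarrow> 'a::banach \<Rightarrow> 'a)
    \<Rightarrow> ('k \<Rightarrow> 'b::real_normed_vector \<Rightarrow> 'b) \<Rightarrow> ('a \<Rightarrow> 'b) set" where
  "linear_ops s t = {T. bounded_linear T \<and> (\<forall>c x. T (s c x) = t c (T x))}"

definition compact_ops ::
  "('k::{real_normed_field,euclidean_space} \<Rightarrow> 'a::banach \<Rightarrow> 'a)
    \<Rightarrow> ('k \<Rightarrow> 'b::real_normed_vector \<Rightarrow> 'b) \<Rightarrow> ('a \<Rightarrow> 'b) set" where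
  "compact_ops s t = {T \<in> linear_ops s t. compact (closure (T ` cball 0 1))}"

definition dual ::
  "('k::{real_normed_field,euclidean_space} \<Rightarrow> 'a::banach \<Rightarrow> 'a) \<Rightarrow> ('a \<Rightarrow> 'k) set" where
  "dual s = linear_ops s (*)"

definition weakly_null ::
  "('k::{real_normed_field,euclidean_space} \<Rightarrow> 'a::banach \<Rightarrow> 'a) \<Rightarrow> (nat \<Rightarrow> 'a) \<Rightarrow> bool" where
  "weakly_null s x \<longleftrightarrow> (\<forall>f\<in>dual s. (\<lambda>n. f (x n)) \<longlonglongrightarrow> 0)"

text \<open>
  As \<open>p\<close> is a term, \<open>\<ell>\<^sub>p\<close> is not a type but a set of sequences with its own norm. So
  the spaces of operators into \<open>\<ell>\<^sub>p\<close> and their duals are likewise sets of functions with explicit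
  norms. Addition on them is the pointwise one of \<^theory>\<open>HOL-Library.Function_Algebras\<close>.
\<close>

definition scale_fun :: "('k \<Rightarrow> 'v \<Rightarrow> 'v) \<Rightarrow> 'k \<Rightarrow> ('i \<Rightarrow> 'v) \<Rightarrow> 'i \<Rightarrow> 'v" where
  "scale_fun s c f = (\<lambda>i. s c (f i))"

definition lp :: "real \<Rightarrow> (nat \<Rightarrow> 'k::real_normed_field) set" where
  "lp p = {a. summable (\<lambda>i. norm (a i) powr p)}"

definition lp_norm :: "real \<Rightarrow> (nat \<Rightarrow> 'k::real_normed_field) \<Rightarrow> real" where
  "lp_norm p a = (\<Sum>i. norm (a i) powr p) powr (1 / p)"

definition lp_topology :: "real \<Rightarrow> (nat \<Rightarrow> 'k::real_normed_field) topology" where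
  "lp_topology p = Metric_space.mtopology (lp p) (\<lambda>a b. lp_norm p (a - b))"

definition lp_linear_ops ::
  "('k::{real_normed_field,euclidean_space} \<Rightarrow> 'a::banach \<Rightarrow> 'a) \<Rightarrow> real
    \<Rightarrow> ('a \<Rightarrow> nat \<Rightarrow> 'k) set" where
  "lp_linear_ops s p = {T. range T \<subseteq> lp p
     \<and> (\<forall>x y. T (x + y) = T x + T y)
     \<and> (\<forall>c x. T (s c x) = scale_fun (*) c (T x))
     \<and> (\<exists>C. \<forall>x. lp_norm p (T x) \<le> C * norm x)}"

text \<open>The quotient form, with \<open>0 / 0 = 0\<close>, follows \<^const>\<open>onorm\<close>.\<close>

definition lp_op_norm :: "real \<Rightarrow> ('a::real_normed_vector \<Rightarrow> nat \<Rightarrow> 'k::real_normed_field) \<Rightarrow> real"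
  where "lp_op_norm p T = (SUP x. lp_norm p (T x) / norm x)"

definition lp_compact_ops ::
  "('k::{real_normed_field,euclidean_space} \<Rightarrow> 'a::banach \<Rightarrow> 'a) \<Rightarrow> real
    \<Rightarrow> ('a \<Rightarrow> nat \<Rightarrow> 'k) set" where
  "lp_compact_ops s p = {T \<in> lp_linear_ops s p.
     compactin (lp_topology p) (lp_topology p closure_of (T ` cball 0 1))}"

text \<open>
  In the following, a normed space over \<open>'k\<close> is given by its scalar multiplication \<open>s\<close>,
  its norm \<open>N\<close> and its set of elements \<open>E\<close>. Functionals are extended by \<open>0\<close> outside \<open>E\<close>, so
  that equality of functionals is equality on \<open>E\<close>.
\<close>

definition dual_on ::
  "('k::real_normed_field \<Rightarrow> 'v::ab_group_add \<Rightarrow> 'v) \<Rightarrow> ('v \<Rightarrow> real) \<Rightarrow> 'v set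
    \<Rightarrow> ('v \<Rightarrow> 'k) set" where
  "dual_on s N E = {f.
     (\<forall>x\<in>E. \<forall>y\<in>E. f (x + y) = f x + f y)
     \<and> (\<forall>c. \<forall>x\<in>E. f (s c x) = c * f x)
     \<and> (\<exists>C. \<forall>x\<in>E. norm (f x) \<le> C * N x)
     \<and> (\<forall>x. x \<notin> E \<longrightarrow> f x = 0)}"

definition dual_norm_on :: "('v \<Rightarrow> real) \<Rightarrow> 'v set \<Rightarrow> ('v \<Rightarrow> 'k::real_normed_field) \<Rightarrow> real" where
  "dual_norm_on N E f = (SUP x\<in>E. norm (f x) / N x)"

definition closed_subspace_on ::
  "('k::real_normed_field \<Rightarrow> 'v::ab_group_add \<Rightarrow> 'v) \<Rightarrow> ('v \<Rightarrow> real) \<Rightarrow> 'v set \<Rightarrow> 'v set \<Rightarrow> bool" where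
  "closed_subspace_on s N E J \<longleftrightarrow> J \<subseteq> E \<and> module.subspace s J
     \<and> (\<forall>u x. range u \<subseteq> J \<longrightarrow> x \<in> E \<longrightarrow> (\<lambda>n. N (u n - x)) \<longlonglongrightarrow> 0 \<longrightarrow> x \<in> J)"

definition annihilator_on ::
  "('k::real_normed_field \<Rightarrow> 'v::ab_group_add \<Rightarrow> 'v) \<Rightarrow> ('v \<Rightarrow> real) \<Rightarrow> 'v set \<Rightarrow> 'v set
    \<Rightarrow> ('v \<Rightarrow> 'k) set" where
  "annihilator_on s N E J = {f \<in> dual_on s N E. \<forall>x\<in>J. f x = 0}"

definition M_ideal_on ::
  "('k::real_normed_field \<Rightarrow> 'v::ab_group_add \<Rightarrow> 'v) \<Rightarrow> ('v \<Rightarrow> real) \<Rightarrow> 'v set \<Rightarrow> 'v set \<Rightarrow> bool" where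
  "M_ideal_on s N E J \<longleftrightarrow> closed_subspace_on s N E J
     \<and> (\<exists>V. closed_subspace_on (scale_fun (*)) (dual_norm_on N E) (dual_on s N E) V
          \<and> {u + v |u v. u \<in> annihilator_on s N E J \<and> v \<in> V} = dual_on s N E
          \<and> annihilator_on s N E J \<inter> V = {0}
          \<and> (\<forall>u\<in>annihilator_on s N E J. \<forall>v\<in>V.
               dual_norm_on N E (u + v) = dual_norm_on N E u + dual_norm_on N E v))"

end

theory Submission
  imports Defs
begin

text \<open>
  Along an ultrafilter-like refinement of \<open>sequentially\<close>, put
  \<open>(P \<phi>) T = lim \<phi> (T K\<^sub>n)\<close>. As \<open>T K\<^sub>n\<close> is compact and tends to \<open>T\<close> for compact \<open>T\<close>, \<open>P\<close> is a
  projection of the dual whose kernel is the annihilator of the compact operators; the range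
  of \<open>P\<close> is the complement \<open>V\<close>. That the sum is an \<open>\<ell>\<^sub>1\<close>-sum reduces to the estimate
  \<open>\<parallel>S K\<^sub>l + T (Id - K\<^sub>m)\<parallel> \<le> 1 + \<epsilon>\<close> for contractions \<open>S\<close>, \<open>T\<close>, large \<open>l\<close>, and \<open>m\<close> large depending
  on \<open>l\<close>. Up to \<open>\<epsilon>\<close>, \<open>S K\<^sub>l\<close> lives on finitely many coordinates of \<open>\<ell>\<^sub>p\<close> and \<open>T (Id - K\<^sub>m)\<close> on
  the others, so it is enough that \<open>\<parallel>K\<^sub>l x\<parallel>\<^sup>p + \<parallel>x - K\<^sub>m x\<parallel>\<^sup>p \<le> 1 + \<epsilon>\<close> on the unit ball. If this fails
  along a sequence, then along a subsequence \<open>K\<^sub>l x\<close> converges in norm to some \<open>z\<close> while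
  \<open>y = x - K\<^sub>m x\<close> is weakly null, and the hypothesis on \<open>X\<close> is violated because
  \<open>\<parallel>z + y\<parallel>\<close> and \<open>\<parallel>z - y\<parallel>\<close> are asymptotically at most \<open>1 + \<epsilon>\<close>.
\<close>

section \<open>Limits along a filter and a criterion for M-ideals\<close>

text \<open>A substitute for an ultrafilter, obtained from Tychonoff's theorem.\<close>

lemma exists_limit_filter:
  "\<exists>G::nat filter. G \<noteq> bot \<and> G \<le> sequentially
     \<and> (\<forall>u::nat \<Rightarrow> 'b::{real_normed_vector,heine_borel}. Bseq u \<longrightarrow> (\<exists>l. (u \<longlongrightarrow> l) G))"
proof -
  define S where "S u = closure (range u)" for u :: "nat \<Rightarrow> 'b"
  have S: "compactin euclidean (S u)" if "Bseq u" for u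
    using that by (simp add: S_def Bseq_eq_bounded compact_closure)
  \<comment> \<open>Each index \<open>n\<close> becomes the point whose coordinate at a bounded
    \<open>u\<close> is \<open>u n\<close>. Unbounded sequences get the constant coordinate 0, so
    that the product \<open>U\<close> is compact.\<close>
  let ?c = "\<lambda>n u. if Bseq u then u n else (0::'b)"
  define U where "U = PiE UNIV (\<lambda>u. if Bseq u then S u else {0::'b})"
  have "compactin (product_topology (\<lambda>u. euclidean) UNIV) U"
    unfolding U_def compactin_PiE using S by auto
  then have "compact U"
    by (simp add: euclidean_product_topology)
  moreover have "filtermap ?c sequentially \<noteq> bot"
    by (simp add: filtermap_bot_iff)
  moreover have "?c n u \<in> (if Bseq u then S u else {0})" for n u
    using closure_subset[of "range u"] by (auto simp: S_def)
  then have "eventually (\<lambda>f. f \<in> U) (filtermap ?c sequentially)"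
    unfolding eventually_filtermap U_def PiE_UNIV_domain by (intro always_eventually allI Pi_I)
  ultimately have "\<exists>l\<in>U. inf (nhds l) (filtermap ?c sequentially) \<noteq> bot"
    unfolding compact_filter by (elim allE impE)
  then obtain l where l: "inf (nhds l) (filtermap ?c sequentially) \<noteq> bot" by (elim bexE)
  \<comment> \<open>Here \<open>l\<close> is a cluster point of the points \<open>?c n\<close>.
    Pulling back its neighbourhoods refines \<open>sequentially\<close> so that all bounded
    sequences converge at once, each \<open>u\<close> to the coordinate \<open>l u\<close>.\<close>
  define G where "G = inf sequentially (filtercomap ?c (nhds l))"
  have "G \<noteq> bot"
  proof
    assume "G = bot"
    then have "eventually (\<lambda>_. False) G" by simp
    then obtain P R where P: "eventually P sequentially" "eventually R (filtercomap ?c (nhds l))"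
      and PR: "\<And>n. P n \<Longrightarrow> R n \<Longrightarrow> False"
      unfolding G_def eventually_inf by (elim exE conjE) (rule that, assumption+, simp)
    from P(2) obtain Q where Q: "eventually Q (nhds l)" "\<And>n. Q (?c n) \<Longrightarrow> R n"
      unfolding eventually_filtercomap by (elim exE conjE) (rule that, assumption, simp)
    have no: "\<not> Q (?c n)" if "P n" for n using PR[OF that] Q(2)[of n] by blast
    have "eventually (\<lambda>f. \<not> Q f) (filtermap ?c sequentially)"
      unfolding eventually_filtermap using P(1) by (rule eventually_mono) (use no in blast)
    then have "eventually (\<lambda>_. False) (inf (nhds l) (filtermap ?c sequentially))"
      by (rule eventually_inf[THEN iffD2, OF exI, OF exI, OF conjI, OF Q(1) conjI]) simp
    with l show False by (simp add: trivial_limit_def)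
  qed
  moreover have "G \<le> sequentially" by (simp add: G_def)
  moreover have "(u \<longlongrightarrow> l u) G" if "Bseq u" for u
  proof -
    have "(?c \<longlongrightarrow> l) G"
      unfolding G_def by (rule filterlim_mono[OF filterlim_filtercomap]) auto
    moreover have "((\<lambda>f. f u) \<longlongrightarrow> l u) (at l)"
    proof -
      have "continuous_on UNIV (\<lambda>f :: (nat \<Rightarrow> 'b) \<Rightarrow> 'b. f u)"
        by (rule continuous_on_product_coordinates)
      then show ?thesis by (simp add: continuous_on_def)
    qed
    ultimately have "((\<lambda>n. ?c n u) \<longlongrightarrow> l u) G"
      by (rule tendsto_compose[rotated])
    then show ?thesis using that by simp
  qed
  ultimately show ?thesis by blast
qed

section \<open>Normed spaces with an explicit carrier, and their duals\<close>

lemma vector_space_scale_fun: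
  assumes "vector_space s"
  shows "vector_space (scale_fun s)"
proof -
  interpret vector_space s by fact
  show ?thesis
    by unfold_locales
      (simp_all add: scale_fun_def fun_eq_iff scale_right_distrib scale_left_distrib)
qed

lemma vector_space_mult: "vector_space ((*) :: 'k::field \<Rightarrow> 'k \<Rightarrow> 'k)"
  by unfold_locales (simp_all add: algebra_simps)

text \<open>Nothing beyond its type is assumed of \<open>N\<close> outside \<open>E\<close>, because
  an operator norm defined by a supremum is meaningful only on bounded operators.\<close>

locale normed_on = vector_space s
  for s :: "'k::{real_normed_field,euclidean_space} \<Rightarrow> 'v::ab_group_add \<Rightarrow> 'v" +
  fixes N :: "'v \<Rightarrow> real" and E :: "'v set"
  assumes subspace_E: "subspace E"
    and N_nonneg: "x \<in> E \<Longrightarrow> 0 \<le> N x"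
    and N_triangle: "x \<in> E \<Longrightarrow> y \<in> E \<Longrightarrow> N (x + y) \<le> N x + N y"
    and N_scale: "x \<in> E \<Longrightarrow> N (s c x) = norm c * N x"
    and N_eq_0: "x \<in> E \<Longrightarrow> N x = 0 \<Longrightarrow> x = 0"
begin

abbreviation "D \<equiv> dual_on s N E :: ('v \<Rightarrow> 'k) set"
abbreviation "dn \<equiv> dual_norm_on N E :: ('v \<Rightarrow> 'k) \<Rightarrow> real"

lemma zero_in_E: "0 \<in> E" and N_0: "N 0 = 0"
  using subspace_0[OF subspace_E] N_scale[of 0 0] by simp_all

lemmas E_add = subspace_add[OF subspace_E]
  and E_diff = subspace_diff[OF subspace_E]
  and E_scale = subspace_scale[OF subspace_E]

lemma D_add: "f \<in> D \<Longrightarrow> x \<in> E \<Longrightarrow> y \<in> E \<Longrightarrow> f (x + y) = f x + f y"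
  and D_scale: "f \<in> D \<Longrightarrow> x \<in> E \<Longrightarrow> f (s c x) = c * f x"
  and D_outside: "f \<in> D \<Longrightarrow> x \<notin> E \<Longrightarrow> f x = 0"
  unfolding dual_on_def by blast+

lemma D_0: "f \<in> D \<Longrightarrow> f 0 = 0"
  using D_scale[of f 0 0] zero_in_E by simp

lemma D_diff:
  assumes "f \<in> D" "x \<in> E" "y \<in> E"
  shows "f (x - y) = f x - f y"
  using D_add[of f "x - y" y] assms E_diff by simp

lemma bdd_above_dual:
  assumes "f \<in> D"
  shows "bdd_above ((\<lambda>x. norm (f x) / N x) ` E)"
proof -
  obtain C where C: "\<And>x. x \<in> E \<Longrightarrow> norm (f x) \<le> C * N x"
    using assms unfolding dual_on_def by blast
  \<comment> \<open>The maximum covers \<open>N x = 0\<close>, where the quotient is 0 while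
    \<open>C\<close> might be negative.\<close>
  have "norm (f x) / N x \<le> max C 0" if "x \<in> E" for x
  proof (cases "N x = 0")
    case False
    then have "norm (f x) / N x \<le> C"
      using C[OF that] N_nonneg[OF that] by (simp add: divide_simps)
    then show ?thesis by simp
  qed simp
  then show ?thesis by (intro bdd_aboveI2) auto
qed

lemma dual_norm_bound:
  assumes "f \<in> D" "x \<in> E"
  shows "norm (f x) \<le> dn f * N x"
proof (cases "N x = 0")
  case True
  then have "f x = 0" using assms N_eq_0 D_0 by blast
  then show ?thesis using True by simp
next
  case False
  have "norm (f x) / N x \<le> dn f"
    unfolding dual_norm_on_def using assms by (intro cSUP_upper bdd_above_dual)
  then show ?thesis using False N_nonneg[OF assms(2)] by (simp add: divide_simps split: if_splits)
qed

lemma dual_norm_le: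
  assumes "0 \<le> B" "\<And>x. x \<in> E \<Longrightarrow> norm (f x) \<le> B * N x"
  shows "dn f \<le> B"
  unfolding dual_norm_on_def
proof (rule cSUP_least)
  show "E \<noteq> {}" using zero_in_E by blast
  show "norm (f x) / N x \<le> B" if "x \<in> E" for x
    using assms(2)[OF that] N_nonneg[OF that] assms(1) by (cases "N x = 0") (auto simp: divide_simps)
qed

lemma dual_norm_nonneg:
  assumes "f \<in> D"
  shows "0 \<le> dn f"
  unfolding dual_norm_on_def
  by (rule cSUP_upper2[OF bdd_above_dual[OF assms] zero_in_E]) (simp add: N_0)

lemma DI:
  assumes "\<And>x y. x \<in> E \<Longrightarrow> y \<in> E \<Longrightarrow> f (x + y) = f x + f y"
    and "\<And>c x. x \<in> E \<Longrightarrow> f (s c x) = c * f x"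
    and "\<And>x. x \<in> E \<Longrightarrow> norm (f x) \<le> C * N x"
    and "\<And>x. x \<notin> E \<Longrightarrow> f x = 0"
  shows "f \<in> D"
  unfolding dual_on_def using assms by blast

lemma D_plus:
  assumes "f \<in> D" "g \<in> D"
  shows "f + g \<in> D"
proof (rule DI)
  show "norm ((f + g) x) \<le> (dn f + dn g) * N x" if "x \<in> E" for x
    using dual_norm_bound[OF assms(1) that] dual_norm_bound[OF assms(2) that]
      norm_triangle_ineq[of "f x" "g x"] by (simp add: distrib_right)
qed (use assms in \<open>auto simp: D_add D_scale D_outside distrib_left\<close>)

lemma D_scale_fun:
  assumes "f \<in> D"
  shows "scale_fun (*) c f \<in> D"
proof (rule DI)
  show "norm (scale_fun (*) c f x) \<le> (norm c * dn f) * N x" if "x \<in> E" for x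
    using dual_norm_bound[OF assms that] mult_left_mono[of "norm (f x)" "dn f * N x" "norm c"]
    by (simp add: scale_fun_def norm_mult mult.assoc)
qed (use assms in \<open>auto simp: scale_fun_def D_add D_scale D_outside distrib_left\<close>)

lemma D_minus:
  assumes "f \<in> D" "g \<in> D"
  shows "f - g \<in> D"
proof -
  have "f - g = f + scale_fun (*) (-1) g" by (simp add: scale_fun_def fun_eq_iff)
  also have "\<dots> \<in> D" using assms by (intro D_plus D_scale_fun)
  finally show ?thesis .
qed

lemma D_zero: "0 \<in> D"
  by (rule DI[where C = 0]) auto

lemma dual_norm_triangle:
  assumes "f \<in> D" "g \<in> D"
  shows "dn (f + g) \<le> dn f + dn g"
proof (rule dual_norm_le)
  show "norm ((f + g) x) \<le> (dn f + dn g) * N x" if "x \<in> E" for x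
    using dual_norm_bound[OF assms(1) that] dual_norm_bound[OF assms(2) that]
      norm_triangle_ineq[of "f x" "g x"] by (simp add: distrib_right)
qed (use assms dual_norm_nonneg in auto)

lemma unimodular_rotation:
  obtains c :: 'k where "norm c = 1" "c * z = of_real (norm z)"
proof (cases "z = 0")
  case True
  then show ?thesis using that[of 1] by simp
next
  case False
  then show ?thesis using that[of "of_real (norm z) / z"] by (simp add: norm_divide)
qed

text \<open>Every quotient in the supremum defining the dual norm is itself a nonnegative real value
  of \<open>f\<close> on the unit ball, so values of two functionals can be added without
  cancellation.\<close>

lemma normalised:
  assumes "f \<in> D" "x \<in> E"
  obtains y where "y \<in> E" "N y \<le> 1" "f y = of_real (norm (f x) / N x)"
proof -
  obtain c :: 'k where c: "norm c = 1" "c * f x = of_real (norm (f x))"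
    by (rule unimodular_rotation)
  \<comment> \<open>If \<open>N x = 0\<close>, division by zero makes this vector 0 and the required
    value 0 as well, so no case distinction is needed.\<close>
  let ?y = "s (c / of_real (N x)) x"
  have "?y \<in> E" using E_scale assms by blast
  moreover have "N ?y \<le> 1"
    using N_scale[OF assms(2)] c N_nonneg[OF assms(2)] by (simp add: norm_divide)
  moreover have "f ?y = of_real (norm (f x) / N x)"
    using D_scale[OF assms] c by simp
  ultimately show ?thesis using that by blast
qed

text \<open>The assumption \<open>ineq\<close> supplies the reverse triangle inequality. On the test
  vector \<open>A l x + (y - A m y)\<close>, of norm nearly at most 1, the functional
  \<open>u + v\<close> tends to \<open>v x + u y\<close> when first \<open>m\<close> and then
  \<open>l\<close> runs along the limit filter.\<close>

theorem M_ideal_onI: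
  fixes A :: "nat \<Rightarrow> 'v \<Rightarrow> 'v"
  assumes J: "closed_subspace_on s N E J"
    and A_add: "\<And>n x y. x \<in> E \<Longrightarrow> y \<in> E \<Longrightarrow> A n (x + y) = A n x + A n y"
    and A_scale: "\<And>n c x. x \<in> E \<Longrightarrow> A n (s c x) = s c (A n x)"
    and A_J: "\<And>n x. x \<in> E \<Longrightarrow> A n x \<in> J"
    and A_bound: "\<And>n x. x \<in> E \<Longrightarrow> N (A n x) \<le> C * N x"
    and A_conv: "\<And>x. x \<in> J \<Longrightarrow> (\<lambda>n. N (A n x - x)) \<longlonglongrightarrow> 0"
    and ineq: "\<And>x y c. x \<in> E \<Longrightarrow> y \<in> E \<Longrightarrow> N x \<le> 1 \<Longrightarrow> N y \<le> 1 \<Longrightarrow> 1 < c \<Longrightarrow>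
      \<forall>\<^sub>F l in sequentially. \<forall>\<^sub>F m in sequentially. N (A l x + (y - A m y)) \<le> c"
  shows "M_ideal_on s N E J"
proof -
  have JE: "J \<subseteq> E" using J by (simp add: closed_subspace_on_def)
  have A_E: "A n x \<in> E" if "x \<in> E" for n x using A_J[OF that] JE by blast
  obtain G :: "nat filter" where G: "G \<noteq> bot" "G \<le> sequentially"
    "\<And>u :: nat \<Rightarrow> 'k. Bseq u \<Longrightarrow> \<exists>l. (u \<longlongrightarrow> l) G"
    using exists_limit_filter[where 'b = 'k] by blast
  \<comment> \<open>The value 0 outside \<open>E\<close> follows the convention of
    \<open>dual_on\<close>, so that equations between functionals can be checked pointwise.\<close>
  define P where "P f x = (if x \<in> E then Lim G (\<lambda>n. f (A n x)) else 0)" for f :: "'v \<Rightarrow> 'k" and x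
  have fA: "norm (f (A n x)) \<le> dn f * C * N x" if "f \<in> D" "x \<in> E" for f n x
    using dual_norm_bound[OF that(1) A_E[OF that(2)], of n]
      mult_left_mono[OF A_bound[OF that(2), of n] dual_norm_nonneg[OF that(1)]]
    by (simp add: mult.assoc)
  have lim: "((\<lambda>n. f (A n x)) \<longlongrightarrow> P f x) G" if "f \<in> D" "x \<in> E" for f x
  proof -
    have "Bseq (\<lambda>n. f (A n x))"
      using fA[OF that] by (intro BseqI'[where K = "dn f * C * N x"])
    then obtain l where "((\<lambda>n. f (A n x)) \<longlongrightarrow> l) G" using G(3) by blast
    then show ?thesis using tendsto_Lim[of G] G(1) that(2) by (auto simp: P_def)
  qed
  have P_eqI: "P f x = l" if "f \<in> D" "x \<in> E" "((\<lambda>n. f (A n x)) \<longlongrightarrow> l) G" for f x l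
    using tendsto_unique[OF G(1) lim[OF that(1,2)] that(3)] .
  have P_outside: "P f x = 0" if "x \<notin> E" for f x using that by (simp add: P_def)
  have P_bound: "norm (P f x) \<le> dn f * C * N x" if "f \<in> D" "x \<in> E" for f x
    using tendsto_upperbound[OF tendsto_norm[OF lim[OF that]] _ G(1)] fA[OF that] by simp
  have P_D: "P f \<in> D" if f: "f \<in> D" for f
  proof (rule DI)
    fix x y c assume x: "x \<in> E"
    show "P f (s c x) = c * P f x"
      using f x by (intro P_eqI) (auto simp: A_scale D_scale A_E E_scale intro!: tendsto_intros lim)
    assume y: "y \<in> E"
    show "P f (x + y) = P f x + P f y"
      using f x y by (intro P_eqI) (auto simp: A_add D_add A_E E_add intro!: tendsto_intros lim)
  qed (use P_outside P_bound[OF f] in auto)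
  have P_plus: "P (f + g) = P f + P g" if "f \<in> D" "g \<in> D" for f g
  proof
    show "P (f + g) x = (P f + P g) x" for x
    proof (cases "x \<in> E")
      case True
      then show ?thesis using that by (intro P_eqI) (auto intro!: tendsto_intros lim D_plus)
    qed (simp add: P_outside)
  qed
  have P_scale: "P (scale_fun (*) c f) = scale_fun (*) c (P f)" if "f \<in> D" for c f
  proof
    show "P (scale_fun (*) c f) x = scale_fun (*) c (P f) x" for x
    proof (cases "x \<in> E")
      case True
      then show ?thesis using that D_scale_fun[OF that, of c]
        by (intro P_eqI) (auto simp: scale_fun_def intro!: tendsto_intros lim)
    qed (simp add: P_outside scale_fun_def)
  qed
  have P_minus: "P (f - g) = P f - P g" if "f \<in> D" "g \<in> D" for f g
    using P_plus[of "f - g" g] that D_minus by (simp add: algebra_simps)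
  \<comment> \<open>On \<open>J\<close> the approximants converge in norm. Hence
    \<open>f - P f\<close> annihilates \<open>J\<close>, and \<open>P\<close> is idempotent because
    every \<open>A n x\<close> lies in \<open>J\<close>.\<close>
  have P_J: "P f x = f x" if "f \<in> D" "x \<in> J" for f x
  proof (rule P_eqI)
    have "(\<lambda>n. dn f * N (A n x - x)) \<longlonglongrightarrow> 0"
      using tendsto_mult_left[OF A_conv[OF that(2)], of "dn f"] by simp
    moreover have "norm (f (A n x) - f x) \<le> dn f * N (A n x - x)" for n
      using that JE dual_norm_bound[of f "A n x - x"] D_diff[of f "A n x" x] A_E E_diff by auto
    ultimately have "(\<lambda>n. f (A n x) - f x) \<longlonglongrightarrow> 0"
      by (rule_tac Lim_null_comparison[OF always_eventually[OF allI]])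
    then have "(\<lambda>n. f (A n x)) \<longlonglongrightarrow> f x" by (rule LIM_zero_cancel)
    then show "((\<lambda>n. f (A n x)) \<longlongrightarrow> f x) G" using tendsto_mono[OF G(2)] by blast
  qed (use that JE in auto)
  have P_P: "P (P f) = P f" if "f \<in> D" for f
  proof
    show "P (P f) x = P f x" for x
    proof (cases "x \<in> E")
      case True
      have "((\<lambda>n. P f (A n x)) \<longlongrightarrow> P f x) G"
        using lim[OF that True] P_J[OF that A_J[OF True]] by simp
      then show ?thesis using P_eqI[OF P_D[OF that] True] by blast
    qed (simp add: P_outside)
  qed
  \<comment> \<open>This is the range of the projection \<open>P\<close>, written as its set of
    fixed points so that closedness can be tested directly.\<close>
  define V where "V = {f \<in> D. P f = f}"
  define U where "U = annihilator_on s N E J"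
  have P_U: "P u = 0" if "u \<in> U" for u
  proof
    show "P u x = 0 x" for x
    proof (cases "x \<in> E")
      case True
      then show ?thesis
        using that A_J[OF True] by (intro P_eqI) (auto simp: U_def annihilator_on_def)
    qed (simp add: P_outside)
  qed
  interpret dual: vector_space "scale_fun (*) :: 'k \<Rightarrow> ('v \<Rightarrow> 'k) \<Rightarrow> 'v \<Rightarrow> 'k"
    by (intro vector_space_scale_fun vector_space_mult)
  have V: "closed_subspace_on (scale_fun (*)) dn D V"
    unfolding closed_subspace_on_def
  proof (intro conjI allI impI)
    show "V \<subseteq> D" by (auto simp: V_def)
    show "dual.subspace V"
      unfolding V_def
    proof (rule dual.subspaceI)
      have "P 0 = 0" using P_minus[of 0 0] D_zero by simp
      then show "0 \<in> {f \<in> D. P f = f}" using D_zero by simp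
    qed (auto simp: D_plus P_plus D_scale_fun P_scale)
    fix u x assume u: "range u \<subseteq> V" and x: "x \<in> D" and conv: "(\<lambda>n. dn (u n - x)) \<longlonglongrightarrow> 0"
    have uD: "u n \<in> D" and Pu: "P (u n) = u n" for n using u by (auto simp: V_def)
    have "P x y = x y" for y
    proof (cases "y \<in> E")
      case True
      \<comment> \<open>As \<open>u n\<close> is fixed by the bounded map \<open>P\<close>, the
        defect \<open>P x - x\<close> is controlled by the distance from \<open>u n\<close> to
        \<open>x\<close>.\<close>
      have "norm (P x y - x y) \<le> dn (u n - x) * (C * N y + N y)" for n
      proof -
        have "P x y - x y = (u n - x) y - P (u n - x) y"
          using P_minus[OF uD x, of n] Pu[of n] by simp
        also have "norm \<dots> \<le> norm ((u n - x) y) + norm (P (u n - x) y)"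
          by (rule norm_triangle_ineq4)
        also have "\<dots> \<le> dn (u n - x) * N y + dn (u n - x) * C * N y"
          using dual_norm_bound[OF D_minus[OF uD x] True] P_bound[OF D_minus[OF uD x] True]
          by (intro add_mono)
        finally show ?thesis by (simp add: algebra_simps)
      qed
      moreover have "(\<lambda>n. dn (u n - x) * (C * N y + N y)) \<longlonglongrightarrow> 0"
        using tendsto_mult_right[OF conv, of "C * N y + N y"] by simp
      ultimately have "norm (P x y - x y) \<le> 0"
        by (intro tendsto_lowerbound) auto
      then show ?thesis by simp
    qed (simp add: P_outside D_outside[OF x])
    then show "x \<in> V" using x by (auto simp: V_def)
  qed
  have UD: "U \<subseteq> D" and VD: "V \<subseteq> D" by (auto simp: U_def annihilator_on_def V_def)
  have sum: "{u + v |u v. u \<in> U \<and> v \<in> V} = D"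
  proof (intro subset_antisym subsetI)
    fix f assume f: "f \<in> D"
    then have "f - P f \<in> U" using P_J[OF f] D_minus P_D by (simp add: U_def annihilator_on_def)
    moreover have "P f \<in> V" using f P_D P_P by (simp add: V_def)
    moreover have "f = (f - P f) + P f" by simp
    ultimately show "f \<in> {u + v |u v. u \<in> U \<and> v \<in> V}" by blast
  qed (use UD VD D_plus in blast)
  have inter: "U \<inter> V = {0}"
  proof -
    have "f = 0" if "f \<in> U" "f \<in> V" for f using P_U[OF that(1)] that(2) by (simp add: V_def)
    moreover have "0 \<in> U" using D_zero by (simp add: U_def annihilator_on_def)
    moreover have "0 \<in> V" using V dual.subspace_0 by (auto simp: closed_subspace_on_def)
    ultimately show ?thesis by blast
  qed
  have norm_sum: "dn (u + v) = dn u + dn v" if uv: "u \<in> U" "v \<in> V" for u v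
  proof (rule antisym)
    let ?f = "u + v"
    have u: "u \<in> D" and v: "v \<in> D" using uv UD VD by auto
    then show "dn ?f \<le> dn u + dn v" by (rule dual_norm_triangle)
    have f: "?f \<in> D" using u v by (rule D_plus)
    have Pf: "P ?f = v" using P_plus[OF u v] P_U[OF uv(1)] uv(2) by (simp add: V_def)
    \<comment> \<open>Both test vectors are rotated so that the two functional values are
      nonnegative reals; the absolute value of their sum is then the sum of the quotients.\<close>
    have key: "norm (u y) / N y + norm (v x) / N x \<le> dn ?f" if "x \<in> E" "y \<in> E" for x y
    proof -
      obtain x' where x': "x' \<in> E" "N x' \<le> 1" "v x' = of_real (norm (v x) / N x)"
        using normalised[OF v \<open>x \<in> E\<close>] .
      obtain y' where y': "y' \<in> E" "N y' \<le> 1" "u y' = of_real (norm (u y) / N y)"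
        using normalised[OF u \<open>y \<in> E\<close>] .
      let ?t = "norm (u y) / N y + norm (v x) / N x"
      have lim_x: "((\<lambda>l. ?f (A l x')) \<longlongrightarrow> v x') G"
        using lim[OF f x'(1)] Pf by simp
      have lim_y: "((\<lambda>m. ?f (y' - A m y')) \<longlongrightarrow> u y') G"
      proof -
        have "((\<lambda>m. ?f y' - ?f (A m y')) \<longlongrightarrow> ?f y' - v y') G"
          using lim[OF f y'(1)] Pf by (intro tendsto_intros) simp
        then show ?thesis using D_diff[OF f y'(1) A_E[OF y'(1)]] by simp
      qed
      have bound: "?t \<le> dn ?f * c" if "1 < c" for c
      proof -
        from ineq[OF x'(1) y'(1) x'(2) y'(2) that]
        \<comment> \<open>Both quantifiers pass from \<open>sequentially\<close> to the finer filter
          \<open>G\<close>.\<close>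
        have "\<forall>\<^sub>F l in G. \<forall>\<^sub>F m in G. N (A l x' + (y' - A m y')) \<le> c"
          by (rule filter_leD[OF G(2) eventually_mono]) (rule filter_leD[OF G(2)])
        then have "\<forall>\<^sub>F l in G. norm (?f (A l x') + u y') \<le> dn ?f * c"
        proof (rule eventually_mono)
          fix l assume l: "\<forall>\<^sub>F m in G. N (A l x' + (y' - A m y')) \<le> c"
          have "((\<lambda>m. norm (?f (A l x') + ?f (y' - A m y'))) \<longlongrightarrow> norm (?f (A l x') + u y')) G"
            by (intro tendsto_intros lim_y)
          moreover have "\<forall>\<^sub>F m in G. norm (?f (A l x') + ?f (y' - A m y')) \<le> dn ?f * c"
            using l
          proof (rule eventually_mono)
            fix m assume m: "N (A l x' + (y' - A m y')) \<le> c"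
            have in_E: "A l x' \<in> E" "y' - A m y' \<in> E" using x' y' A_E E_diff by auto
            have "norm (?f (A l x') + ?f (y' - A m y')) \<le> dn ?f * N (A l x' + (y' - A m y'))"
              using dual_norm_bound[OF f E_add[OF in_E]] D_add[OF f in_E] by simp
            also have "\<dots> \<le> dn ?f * c" using m dual_norm_nonneg[OF f] by (rule mult_left_mono)
            finally show "norm (?f (A l x') + ?f (y' - A m y')) \<le> dn ?f * c" .
          qed
          ultimately show "norm (?f (A l x') + u y') \<le> dn ?f * c"
            by (rule tendsto_upperbound[OF _ _ G(1)])
        qed
        moreover have "((\<lambda>l. norm (?f (A l x') + u y')) \<longlongrightarrow> norm (v x' + u y')) G"
          by (intro tendsto_intros lim_x)
        ultimately have "norm (v x' + u y') \<le> dn ?f * c"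
          by (intro tendsto_upperbound[OF _ _ G(1)])
        also have "v x' + u y' = of_real ?t" using x' y' by simp
        finally show ?thesis unfolding norm_of_real by linarith
      qed
      \<comment> \<open>The constant \<open>c\<close> decreases to 1 along
        \<open>1 + 1 / (n + 1)\<close>.\<close>
      have "(\<lambda>n. dn ?f * (1 + inverse (real (Suc n)))) \<longlonglongrightarrow> dn ?f * (1 + 0)"
        by (intro tendsto_intros LIMSEQ_inverse_real_of_nat)
      moreover have "?t \<le> dn ?f * (1 + inverse (real (Suc n)))" for n
        by (rule bound) simp
      ultimately show ?thesis by (intro tendsto_lowerbound[where F = sequentially]) auto
    qed
    \<comment> \<open>The two suprema are taken separately: over \<open>x\<close> for fixed
      \<open>y\<close> in the inner step, over \<open>y\<close> in the outer one.\<close>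
    have "dn u \<le> dn ?f - dn v"
      unfolding dual_norm_on_def[of N E u]
    proof (rule cSUP_least)
      show "E \<noteq> {}" using zero_in_E by blast
      fix y assume y: "y \<in> E"
      have "dn v \<le> dn ?f - norm (u y) / N y"
        unfolding dual_norm_on_def[of N E v]
      proof (rule cSUP_least)
        show "E \<noteq> {}" using zero_in_E by blast
        show "norm (v x) / N x \<le> dn ?f - norm (u y) / N y" if "x \<in> E" for x
          using key[OF that y] by simp
      qed
      then show "norm (u y) / N y \<le> dn ?f - dn v" by simp
    qed
    then show "dn u + dn v \<le> dn ?f" by simp
  qed
  show ?thesis
    unfolding M_ideal_on_def U_def[symmetric]
    by (intro conjI exI[of _ V] ballI J V sum inter norm_sum)
qed

end

section \<open>The sequence space\<close>

lemma powr_convex_le: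
  fixes u v t p :: real
  assumes "1 \<le> p" "0 \<le> u" "0 \<le> v" "0 \<le> t" "t \<le> 1"
  shows "((1 - t) * u + t * v) powr p \<le> (1 - t) * u powr p + t * v powr p"
proof -
  \<comment> \<open>When \<open>u\<close> or \<open>v\<close> is 0, the claim reduces to this bound;
    convexity on the open half line settles the remaining case.\<close>
  have less: "t powr p \<le> t" if "0 \<le> t" "t \<le> 1" for t :: real
    using powr_mono'[of 1 p t] that assms(1) by (cases "t = 0") auto
  consider "u = 0" | "v = 0" | "0 < u" "0 < v" using assms by linarith
  then show ?thesis
  proof cases
    case 1
    then show ?thesis using assms less[of t] by (simp add: powr_mult mult_right_mono)
  next
    case 2
    then show ?thesis using assms less[of "1 - t"] by (simp add: powr_mult mult_right_mono)
  next
    case 3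
    then show ?thesis
      using convex_onD[OF powr_convex[OF assms(1)], of t u v] assms by simp
  qed
qed

text \<open>After normalisation, \<open>a + b\<close> is a multiple of a convex combination of
  \<open>a / A\<close> and \<open>b / B\<close>, and convexity applies term by term. Only upper
  bounds \<open>A\<close>, \<open>B\<close> are asked for, so that norms of whole sequences can
  bound finite sections.\<close>

lemma sum_powr_minkowski:
  fixes a b :: "'i \<Rightarrow> 'k::real_normed_vector"
  assumes "1 \<le> p" "0 \<le> A" "0 \<le> B" "finite I"
    and a: "(\<Sum>i\<in>I. norm (a i) powr p) \<le> A powr p"
    and b: "(\<Sum>i\<in>I. norm (b i) powr p) \<le> B powr p"
  shows "(\<Sum>i\<in>I. norm (a i + b i) powr p) \<le> (A + B) powr p"
proof -
  have vanish: "\<forall>i\<in>I. f i = 0" if "(\<Sum>i\<in>I. norm (f i) powr p) \<le> 0" for f :: "'i \<Rightarrow> 'k"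
    using that \<open>finite I\<close> sum_nonneg_eq_0_iff[of I "\<lambda>i. norm (f i) powr p"]
      sum_nonneg[of I "\<lambda>i. norm (f i) powr p"] by auto
  \<comment> \<open>The normalisation divides by \<open>A\<close> and \<open>B\<close>; if one of
    them is 0, the corresponding family vanishes on \<open>I\<close>.\<close>
  consider "A = 0" | "B = 0" | "0 < A" "0 < B" using assms by linarith
  then show ?thesis
  proof cases
    case 1
    then show ?thesis using a b vanish[of a] by simp
  next
    case 2
    then show ?thesis using a b vanish[of b] by simp
  next
    case 3
    \<comment> \<open>With this weight, \<open>(A + B) * (1 - t) = A\<close> and
      \<open>(A + B) * t = B\<close>, so the combination reproduces
      \<open>norm (a i) + norm (b i)\<close>.\<close>
    define t where "t = B / (A + B)"
    have t: "0 \<le> t" "t \<le> 1" and s: "1 - t = A / (A + B)"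
      using 3 by (auto simp: t_def field_simps)
    have bnd: "norm (a i + b i) powr p
        \<le> (A + B) powr p * ((1 - t) * (norm (a i) powr p / A powr p) + t * (norm (b i) powr p / B powr p))" for i
    proof -
      have "norm (a i + b i) powr p \<le> (norm (a i) + norm (b i)) powr p"
        using assms by (intro powr_mono2 norm_triangle_ineq) auto
      also have "norm (a i) + norm (b i) = (A + B) * ((1 - t) * (norm (a i) / A) + t * (norm (b i) / B))"
      proof -
        have "(A + B) * (A / (A + B) * (norm (a i) / A)) = norm (a i)"
          "(A + B) * (B / (A + B) * (norm (b i) / B)) = norm (b i)"
          using 3 by (auto simp: divide_simps)
        then show ?thesis
          using distrib_left[of "A + B" "A / (A + B) * (norm (a i) / A)" "B / (A + B) * (norm (b i) / B)"]
          unfolding s unfolding t_def by simp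
      qed
      also have "\<dots> powr p = (A + B) powr p * ((1 - t) * (norm (a i) / A) + t * (norm (b i) / B)) powr p"
        using 3 t by (intro powr_mult)
      also have "\<dots> \<le> (A + B) powr p * ((1 - t) * (norm (a i) / A) powr p + t * (norm (b i) / B) powr p)"
        using 3 t assms by (intro mult_left_mono powr_convex_le) auto
      finally show ?thesis using 3 by (simp add: powr_divide)
    qed
    have "(\<Sum>i\<in>I. norm (a i + b i) powr p) \<le> (\<Sum>i\<in>I. (A + B) powr p *
        ((1 - t) * (norm (a i) powr p / A powr p) + t * (norm (b i) powr p / B powr p)))"
      by (intro sum_mono bnd)
    also have "\<dots> = (A + B) powr p * ((1 - t) * ((\<Sum>i\<in>I. norm (a i) powr p) / A powr p)
        + t * ((\<Sum>i\<in>I. norm (b i) powr p) / B powr p))"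
      by (simp add: sum_distrib_left sum.distrib sum_divide_distrib distrib_left)
    also have "\<dots> \<le> (A + B) powr p * ((1 - t) * 1 + t * 1)"
      using 3 t a b by (intro mult_left_mono add_mono) auto
    finally show ?thesis by simp
  qed
qed

section \<open>Norm, metric and completeness of the sequence space\<close>

lemma lp_norm_nonneg [simp]: "0 \<le> lp_norm p a"
  by (simp add: lp_norm_def)

lemma sum_le_lp_norm:
  assumes "0 < p" "a \<in> lp p" "finite I"
  shows "(\<Sum>i\<in>I. norm (a i) powr p) \<le> lp_norm p a powr p"
proof -
  have "(\<Sum>i\<in>I. norm (a i) powr p) \<le> (\<Sum>i. norm (a i) powr p)"
    using assms by (intro sum_le_suminf) (auto simp: lp_def)
  also have "\<dots> = lp_norm p a powr p"
    using assms by (simp add: lp_norm_def powr_powr suminf_nonneg lp_def)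
  finally show ?thesis .
qed

lemma norm_le_lp_norm:
  assumes "0 < p" "a \<in> lp p"
  shows "norm (a i) \<le> lp_norm p a"
  using sum_le_lp_norm[OF assms, of "{i}"] powr_less_mono2[of p "lp_norm p a" "norm (a i)"] assms(1)
  by force

text \<open>Partial sums control membership and norm together, so later estimates need to treat
  finite sums only.\<close>

lemma lp_boundI:
  assumes "0 < p" "0 \<le> B" "\<And>n. (\<Sum>i<n. norm (a i) powr p) \<le> B powr p"
  shows "a \<in> lp p" "lp_norm p a \<le> B"
proof -
  show a: "a \<in> lp p"
    unfolding lp_def mem_Collect_eq
  proof (rule bounded_imp_summable)
    show "(\<Sum>i\<le>n. norm (a i) powr p) \<le> B powr p" for n
      using assms(3)[of "Suc n"] by (simp add: lessThan_Suc_atMost)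
  qed simp
  have "(\<Sum>i. norm (a i) powr p) \<le> B powr p"
    using a assms(3) by (intro suminf_le_const) (auto simp: lp_def)
  then have "lp_norm p a \<le> (B powr p) powr (1 / p)"
    unfolding lp_norm_def using a assms(1) by (intro powr_mono2) (auto simp: lp_def suminf_nonneg)
  then show "lp_norm p a \<le> B"
    using assms by (simp add: powr_powr)
qed

lemma lp_zero [simp]: "0 < p \<Longrightarrow> 0 \<in> lp p" "0 < p \<Longrightarrow> lp_norm p 0 = 0"
  by (auto simp: lp_def lp_norm_def zero_fun_def)

lemma lp_norm_eq_0:
  assumes "0 < p" "a \<in> lp p" "lp_norm p a = 0"
  shows "a = 0"
  using norm_le_lp_norm[OF assms(1,2)] assms(3) by (auto simp: fun_eq_iff)

lemma lp_add:
  assumes "1 < p" "a \<in> lp p" "b \<in> lp p"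
  shows "a + b \<in> lp p" "lp_norm p (a + b) \<le> lp_norm p a + lp_norm p b"
proof -
  have "(\<Sum>i<n. norm ((a + b) i) powr p) \<le> (lp_norm p a + lp_norm p b) powr p" for n
    using assms sum_powr_minkowski[of p "lp_norm p a" "lp_norm p b" "{..<n}" a b]
    by (simp add: sum_le_lp_norm)
  then show "a + b \<in> lp p" "lp_norm p (a + b) \<le> lp_norm p a + lp_norm p b"
    using lp_boundI[of p "lp_norm p a + lp_norm p b" "a + b"] assms by auto
qed

lemma lp_scale:
  assumes "0 < p" "a \<in> lp p"
  shows "scale_fun (*) c a \<in> lp p" "lp_norm p (scale_fun (*) c a) = norm c * lp_norm p a"
proof -
  show "scale_fun (*) c a \<in> lp p"
    using assms by (auto simp: lp_def scale_fun_def norm_mult powr_mult)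
  have "(\<Sum>i. norm c powr p * norm (a i) powr p) = norm c powr p * (\<Sum>i. norm (a i) powr p)"
    using assms by (intro suminf_mult) (auto simp: lp_def)
  then show "lp_norm p (scale_fun (*) c a) = norm c * lp_norm p a"
    using assms by (simp add: lp_norm_def scale_fun_def norm_mult powr_mult powr_powr lp_def suminf_nonneg)
qed

lemma lp_minus:
  assumes "0 < p" "a \<in> lp p"
  shows "- a \<in> lp p" "lp_norm p (- a) = lp_norm p a"
  using assms by (auto simp: lp_def lp_norm_def fun_Compl_def)

lemma lp_diff:
  assumes "1 < p" "a \<in> lp p" "b \<in> lp p"
  shows "a - b \<in> lp p" "lp_norm p (a - b) \<le> lp_norm p a + lp_norm p b"
  using lp_add[of p a "- b"] lp_minus[of p b] assms by auto

lemma Metric_space_lp: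
  assumes "1 < p"
  shows "Metric_space (lp p :: (nat \<Rightarrow> 'k::real_normed_field) set) (\<lambda>a b. lp_norm p (a - b))"
proof
  fix a b c :: "nat \<Rightarrow> 'k"
  show "lp_norm p (a - b) = lp_norm p (b - a)"
    by (simp add: lp_norm_def norm_minus_commute)
  { assume ab: "a \<in> lp p" "b \<in> lp p"
    show "lp_norm p (a - b) = 0 \<longleftrightarrow> a = b"
      using lp_norm_eq_0[of p "a - b"] lp_diff[OF assms ab] assms by auto }
  assume "a \<in> lp p" "b \<in> lp p" "c \<in> lp p"
  then show "lp_norm p (a - c) \<le> lp_norm p (a - b) + lp_norm p (b - c)"
    using lp_add[of p "a - b" "b - c"] lp_diff assms by auto
qed simp

text \<open>A Cauchy sequence converges in each coordinate, and its norm estimates survive the limit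
  on every finite section. Completeness serves to identify relatively compact sets with totally
  bounded ones.\<close>

lemma mcomplete_lp:
  assumes p: "1 < p"
  shows "Metric_space.mcomplete (lp p :: (nat \<Rightarrow> 'k::{real_normed_field,complete_space}) set) (\<lambda>a b. lp_norm p (a - b))"
proof -
  interpret Metric_space "lp p :: (nat \<Rightarrow> 'k) set" "\<lambda>a b. lp_norm p (a - b)"
    by (rule Metric_space_lp[OF p])
  show ?thesis
    unfolding mcomplete_def
  proof (intro allI impI)
    fix \<sigma> :: "nat \<Rightarrow> nat \<Rightarrow> 'k" assume \<sigma>: "MCauchy \<sigma>"
    then have lp: "\<sigma> n \<in> lp p" for n by (auto simp: MCauchy_def)
    have "Cauchy (\<lambda>n. \<sigma> n i)" for i
    proof (rule metric_CauchyI)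
      fix e :: real assume "0 < e"
      then obtain N where N: "\<And>n n'. N \<le> n \<Longrightarrow> N \<le> n' \<Longrightarrow> lp_norm p (\<sigma> n - \<sigma> n') < e"
        using \<sigma> unfolding MCauchy_def by blast
      have "dist (\<sigma> m i) (\<sigma> n i) < e" if "N \<le> m" "N \<le> n" for m n
        using norm_le_lp_norm[of p "\<sigma> m - \<sigma> n" i] N[OF that] lp_diff(1)[OF p lp lp] p
        by (simp add: dist_norm)
      then show "\<exists>M. \<forall>m\<ge>M. \<forall>n\<ge>M. dist (\<sigma> m i) (\<sigma> n i) < e" by blast
    qed
    then have "\<forall>i. \<exists>l. (\<lambda>n. \<sigma> n i) \<longlonglongrightarrow> l"
      by (simp add: Cauchy_convergent_iff convergent_def)
    then obtain x where x: "\<And>i. (\<lambda>n. \<sigma> n i) \<longlonglongrightarrow> x i"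
      by (auto dest!: choice)
    have close: "\<exists>N. \<forall>n\<ge>N. \<sigma> n - x \<in> lp p \<and> lp_norm p (\<sigma> n - x) \<le> e" if "0 < e" for e
    proof -
      obtain N where N: "\<And>n n'. N \<le> n \<Longrightarrow> N \<le> n' \<Longrightarrow> lp_norm p (\<sigma> n - \<sigma> n') < e"
        using \<sigma> \<open>0 < e\<close> unfolding MCauchy_def by blast
      \<comment> \<open>The limit in \<open>m\<close> is taken with \<open>n\<close> and the finite
        length \<open>k\<close> fixed; the strict bound becomes nonstrict in the process.\<close>
      have "(\<Sum>i<k. norm ((\<sigma> n - x) i) powr p) \<le> e powr p" if "N \<le> n" for n k
      proof (rule tendsto_upperbound)
        show "(\<lambda>m. \<Sum>i<k. norm (\<sigma> n i - \<sigma> m i) powr p) \<longlonglongrightarrow> (\<Sum>i<k. norm ((\<sigma> n - x) i) powr p)"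
          unfolding minus_apply using p by (intro tendsto_sum tendsto_powr' tendsto_norm tendsto_diff x tendsto_const) auto
        have "(\<Sum>i<k. norm (\<sigma> n i - \<sigma> m i) powr p) \<le> e powr p" if "N \<le> m" for m
        proof -
          have "(\<Sum>i<k. norm ((\<sigma> n - \<sigma> m) i) powr p) \<le> lp_norm p (\<sigma> n - \<sigma> m) powr p"
            using p by (intro sum_le_lp_norm lp_diff(1)[OF p lp lp]) auto
          also have "\<dots> \<le> e powr p"
            using N[OF \<open>N \<le> n\<close> that] p by (intro powr_mono2) auto
          finally show ?thesis by simp
        qed
        then show "\<forall>\<^sub>F m in sequentially. (\<Sum>i<k. norm (\<sigma> n i - \<sigma> m i) powr p) \<le> e powr p"
          by (auto simp: eventually_sequentially)
      qed simp
      then have "\<sigma> n - x \<in> lp p \<and> lp_norm p (\<sigma> n - x) \<le> e" if "N \<le> n" for n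
        using lp_boundI[of p e "\<sigma> n - x"] p \<open>0 < e\<close> that by simp
      then show ?thesis by blast
    qed
    obtain N where "\<sigma> N - x \<in> lp p" using close[of 1] by auto
    then have "x \<in> lp p"
      using lp_diff(1)[OF p lp, of "\<sigma> N - x" N] by simp
    moreover have "\<forall>\<^sub>F n in sequentially. lp_norm p (\<sigma> n - x) < e" if "0 < e" for e
    proof -
      \<comment> \<open>Halving \<open>e\<close> restores the strict inequality lost in the
        limit.\<close>
      obtain M where M: "\<forall>n\<ge>M. \<sigma> n - x \<in> lp p \<and> lp_norm p (\<sigma> n - x) \<le> e / 2"
        using close[of "e / 2"] \<open>0 < e\<close> by auto
      show ?thesis
        using eventually_ge_at_top[of M] by eventually_elim (use M \<open>0 < e\<close> in force)
    qed
    ultimately show "\<exists>x. limitin mtopology \<sigma> x sequentially"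
      using lp by (auto simp: limitin_metric)
  qed
qed

section \<open>Truncation to finitely many coordinates\<close>

definition lp_head :: "nat \<Rightarrow> (nat \<Rightarrow> 'k::real_normed_field) \<Rightarrow> nat \<Rightarrow> 'k" where
  "lp_head N a = (\<lambda>i. if i < N then a i else 0)"

lemma lp_head_add: "lp_head N (a + b) = lp_head N a + lp_head N b"
  and lp_head_diff: "lp_head N (a - b) = lp_head N a - lp_head N b"
  and lp_head_scale: "lp_head N (scale_fun (*) c a) = scale_fun (*) c (lp_head N a)"
  by (auto simp: lp_head_def scale_fun_def fun_eq_iff)

lemma lp_head_zero [simp]: "lp_head N 0 = 0"
  by (auto simp: lp_head_def)

text \<open>The two pieces have disjoint supports, so their p-th powers add coordinate by
  coordinate. This is where the exponent of the target space meets the exponent of the domain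
  estimate. Taking one piece from the zero sequence shows that heads and tails are
  contractive.\<close>

lemma lp_glue:
  assumes "0 < p" "a \<in> lp p" "b \<in> lp p"
  shows "lp_head N a + (b - lp_head N b) \<in> lp p"
    and "lp_norm p (lp_head N a + (b - lp_head N b)) \<le> (lp_norm p a powr p + lp_norm p b powr p) powr (1 / p)"
proof -
  let ?c = "lp_head N a + (b - lp_head N b)"
  have "(\<Sum>i<n. norm (?c i) powr p) \<le> ((lp_norm p a powr p + lp_norm p b powr p) powr (1 / p)) powr p" for n
  proof -
    have "(\<Sum>i<n. norm (?c i) powr p) \<le> (\<Sum>i<n. norm (a i) powr p + norm (b i) powr p)"
      by (intro sum_mono) (auto simp: lp_head_def)
    also have "\<dots> \<le> lp_norm p a powr p + lp_norm p b powr p"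
      unfolding sum.distrib using assms by (intro add_mono sum_le_lp_norm) auto
    finally show ?thesis using assms by (simp add: powr_powr)
  qed
  note bound = lp_boundI[OF assms(1) powr_ge_zero this]
  show "?c \<in> lp p" by (rule bound(1))
  show "lp_norm p ?c \<le> (lp_norm p a powr p + lp_norm p b powr p) powr (1 / p)" by (rule bound(2))
qed

lemma lp_head_in_lp [simp]: "0 < p \<Longrightarrow> lp_head N a \<in> lp p"
  unfolding lp_def mem_Collect_eq
  by (rule summable_finite[of "{..<N}"]) (auto simp: lp_head_def)

lemma lp_norm_head_le:
  assumes "0 < p" "a \<in> lp p"
  shows "lp_norm p (lp_head N a) \<le> lp_norm p a"
  using lp_glue(2)[OF assms lp_zero(1)[OF assms(1)], of N] assms by (simp add: powr_powr)

lemma lp_norm_tail_le: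
  assumes "0 < p" "a \<in> lp p"
  shows "lp_norm p (a - lp_head N a) \<le> lp_norm p a"
  using lp_glue(2)[OF assms(1) lp_zero(1)[OF assms(1)] assms(2), of N] assms
  by (simp add: powr_powr)

text \<open>This crude bound by the sum of the absolute values, used with \<open>N\<close> fixed,
  turns convergence in each coordinate into norm convergence of heads. The induction splits off one
  coordinate at a time.\<close>

lemma lp_norm_head_le_sum:
  assumes "1 < p"
  shows "lp_norm p (lp_head N a) \<le> (\<Sum>i<N. norm (a i))"
proof (induction N)
  case 0
  then show ?case using assms by (simp add: lp_head_def lp_norm_def)
next
  case (Suc N)
  let ?e = "\<lambda>i. if i = N then a N else 0"
  have "(\<Sum>i<n. norm (?e i) powr p) \<le> norm (a N) powr p" for n
  proof -
    have "(\<Sum>i<n. norm (?e i) powr p) \<le> (\<Sum>i<n. if i = N then norm (a N) powr p else 0)"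
      using assms by (intro sum_mono) auto
    then show ?thesis by (auto split: if_splits)
  qed
  then have e: "?e \<in> lp p" "lp_norm p ?e \<le> norm (a N)"
    using lp_boundI[of p "norm (a N)" ?e] assms by auto
  have "lp_head (Suc N) a = lp_head N a + ?e"
    by (auto simp: lp_head_def fun_eq_iff less_Suc_eq)
  then have "lp_norm p (lp_head (Suc N) a) \<le> lp_norm p (lp_head N a) + lp_norm p ?e"
    using lp_add(2)[OF assms lp_head_in_lp e(1), of N a] assms by simp
  then show ?case using Suc e(2) by simp
qed

text \<open>The p-th power of the tail norm is the remainder of a convergent series.\<close>

lemma lp_tail_tendsto_0:
  assumes "0 < p" "a \<in> lp p"
  shows "(\<lambda>N. lp_norm p (a - lp_head N a)) \<longlonglongrightarrow> 0"
proof -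
  have s: "summable (\<lambda>i. norm (a i) powr p)" using assms by (simp add: lp_def)
  have "lp_norm p (a - lp_head N a) = ((\<Sum>i. norm (a i) powr p) - (\<Sum>i<N. norm (a i) powr p)) powr (1 / p)" for N
  proof -
    have "(\<lambda>i. norm (a i) powr p - (if i \<in> {..<N} then norm (a i) powr p else 0))
        sums ((\<Sum>i. norm (a i) powr p) - (\<Sum>i<N. norm (a i) powr p))"
      by (intro sums_diff summable_sums[OF s] sums_If_finite_set) simp
    moreover have "(\<lambda>i. norm ((a - lp_head N a) i) powr p)
        = (\<lambda>i. norm (a i) powr p - (if i \<in> {..<N} then norm (a i) powr p else 0))"
      using assms by (auto simp: lp_head_def)
    ultimately show ?thesis by (simp add: lp_norm_def sums_iff)
  qed
  \<comment> \<open>The base tends to 0; \<open>powr\<close> is continuous there because the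
    exponent is positive and the remainders are nonnegative.\<close>
  moreover have "(\<lambda>N. ((\<Sum>i. norm (a i) powr p) - (\<Sum>i<N. norm (a i) powr p)) powr (1 / p))
      \<longlonglongrightarrow> ((\<Sum>i. norm (a i) powr p) - (\<Sum>i. norm (a i) powr p)) powr (1 / p)"
    using assms s sum_le_suminf[OF s]
    by (intro tendsto_powr' tendsto_intros summable_LIMSEQ) auto
  ultimately show ?thesis by simp
qed

section \<open>Operators into the sequence space\<close>

locale lp_operators = banach_over scale
  for scale :: "'k::{real_normed_field,euclidean_space} \<Rightarrow> 'a::banach \<Rightarrow> 'a" +
  fixes p :: real
  assumes p: "1 < p"
begin

abbreviation "L \<equiv> lp_linear_ops scale p"
abbreviation "N \<equiv> lp_op_norm p :: ('a \<Rightarrow> nat \<Rightarrow> 'k) \<Rightarrow> real"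

lemma p_pos: "0 < p"
  using p by simp

lemmas lp_add' = lp_add[OF p] and lp_diff' = lp_diff[OF p]

interpretation lp: Metric_space "lp p :: (nat \<Rightarrow> 'k) set" "\<lambda>a b. lp_norm p (a - b)"
  by (rule Metric_space_lp[OF p])

lemma L_lp: "T \<in> L \<Longrightarrow> T x \<in> lp p"
  and L_add: "T \<in> L \<Longrightarrow> T (x + y) = T x + T y"
  and L_scale: "T \<in> L \<Longrightarrow> T (scale c x) = scale_fun (*) c (T x)"
  unfolding lp_linear_ops_def by auto

lemma L_diff: "T \<in> L \<Longrightarrow> T (x - y) = T x - T y"
  using L_add[of T "x - y" y] by simp

lemma L_zero: "T \<in> L \<Longrightarrow> T 0 = 0"
  using L_diff[of T 0 0] by simp

lemma LI:
  assumes "\<And>x. T x \<in> lp p" "\<And>x y. T (x + y) = T x + T y"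
    and "\<And>c x. T (scale c x) = scale_fun (*) c (T x)"
    and "\<And>x. lp_norm p (T x) \<le> C * norm x"
  shows "T \<in> L"
  unfolding lp_linear_ops_def using assms by blast

lemma bdd_above_op:
  assumes "T \<in> L"
  shows "bdd_above (range (\<lambda>x. lp_norm p (T x) / norm x))"
proof -
  obtain C where C: "\<And>x. lp_norm p (T x) \<le> C * norm x"
    using assms unfolding lp_linear_ops_def by blast
  have "lp_norm p (T x) / norm x \<le> max C 0" for x
  proof (cases "x = 0")
    case False
    then have "lp_norm p (T x) / norm x \<le> C"
      using C[of x] by (simp add: divide_simps)
    then show ?thesis by simp
  qed simp
  then show ?thesis by (intro bdd_aboveI2) auto
qed

lemma op_norm_bound:
  assumes "T \<in> L"
  shows "lp_norm p (T x) \<le> N T * norm x"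
proof (cases "x = 0")
  case True
  then show ?thesis using L_zero[OF assms] p_pos by simp
next
  case False
  have "lp_norm p (T x) / norm x \<le> N T"
    unfolding lp_op_norm_def using bdd_above_op[OF assms] by (intro cSUP_upper) auto
  then show ?thesis using False by (simp add: divide_simps)
qed

lemma op_norm_nonneg:
  assumes "T \<in> L"
  shows "0 \<le> N T"
  unfolding lp_op_norm_def
  by (rule cSUP_upper2[OF bdd_above_op[OF assms], of 0]) auto

lemma op_norm_le:
  assumes "0 \<le> B" "\<And>x. lp_norm p (T x) \<le> B * norm x"
  shows "N T \<le> B"
  unfolding lp_op_norm_def
proof (rule cSUP_least)
  show "lp_norm p (T x) / norm x \<le> B" for x
    using assms(2)[of x] assms(1) by (cases "x = 0") (auto simp: divide_simps)
qed simp

lemma op_norm_le_ball: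
  assumes "T \<in> L" "0 \<le> B" "\<And>x. norm x \<le> 1 \<Longrightarrow> lp_norm p (T x) \<le> B"
  shows "N T \<le> B"
proof (rule op_norm_le[OF assms(2)])
  fix x
  show "lp_norm p (T x) \<le> B * norm x"
  proof (cases "x = 0")
    case True
    then show ?thesis using L_zero[OF assms(1)] p_pos by simp
  next
    case False
    let ?c = "of_real (inverse (norm x)) :: 'k"
    have "norm (scale ?c x) \<le> 1"
      using False unfolding norm_scale norm_of_real by simp
    then have "lp_norm p (T (scale ?c x)) \<le> B" by (rule assms(3))
    also have "lp_norm p (T (scale ?c x)) = inverse (norm x) * lp_norm p (T x)"
      unfolding L_scale[OF assms(1)] lp_scale(2)[OF p_pos L_lp[OF assms(1)]] norm_of_real by simp
    finally show ?thesis using False by (simp add: divide_simps)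
  qed
qed

lemma op_norm_ball:
  assumes "T \<in> L" "norm x \<le> 1"
  shows "lp_norm p (T x) \<le> N T"
  using op_norm_bound[OF assms(1), of x] mult_left_mono[OF assms(2) op_norm_nonneg[OF assms(1)]] by simp

lemma L_plus:
  assumes "S \<in> L" "T \<in> L"
  shows "S + T \<in> L" "N (S + T) \<le> N S + N T"
proof -
  have *: "lp_norm p ((S + T) x) \<le> (N S + N T) * norm x" for x
    using lp_add'(2)[OF L_lp[OF assms(1)] L_lp[OF assms(2)], of x x]
      op_norm_bound[OF assms(1), of x] op_norm_bound[OF assms(2), of x]
    by (simp add: distrib_right)
  show "S + T \<in> L"
    by (rule LI[OF _ _ _ *])
      (use assms in \<open>auto simp: lp_add' L_lp L_add L_scale scale_fun_def fun_eq_iff distrib_left\<close>)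
  show "N (S + T) \<le> N S + N T"
    using * assms by (intro op_norm_le) (auto simp: op_norm_nonneg)
qed

lemma L_scale_fun:
  assumes "T \<in> L"
  shows "scale_fun (scale_fun (*)) c T \<in> L" "N (scale_fun (scale_fun (*)) c T) = norm c * N T"
proof -
  have eq: "lp_norm p (scale_fun (scale_fun (*)) c T x) = norm c * lp_norm p (T x)"
    if "T \<in> L" for c x and T :: "'a \<Rightarrow> nat \<Rightarrow> 'k"
    using lp_scale(2)[OF p_pos L_lp[OF that]] by (simp add: scale_fun_def[of "scale_fun (*)"])
  have bound: "lp_norm p (scale_fun (scale_fun (*)) c T x) \<le> (norm c * N T) * norm x"
    if "T \<in> L" for c x and T :: "'a \<Rightarrow> nat \<Rightarrow> 'k"
    using eq[OF that] mult_left_mono[OF op_norm_bound[OF that, of x], of "norm c"] by (simp add: mult.assoc)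
  have mem: "scale_fun (scale_fun (*)) c T \<in> L" if "T \<in> L" for c and T :: "'a \<Rightarrow> nat \<Rightarrow> 'k"
    by (rule LI[OF _ _ _ bound[OF that]])
      (use that L_lp[OF that] lp_scale(1)[OF p_pos, of _ c] in
        \<open>auto simp: scale_fun_def L_add L_scale fun_eq_iff distrib_left\<close>)
  \<comment> \<open>Stated for all operators and scalars, since the reverse inequality below applies
    it to the multiple of \<open>T\<close> by \<open>c\<close> and the scalar
    \<open>inverse c\<close>.\<close>
  have le: "N (scale_fun (scale_fun (*)) c T) \<le> norm c * N T" if "T \<in> L" for c and T :: "'a \<Rightarrow> nat \<Rightarrow> 'k"
    using bound[OF that] op_norm_nonneg[OF that] by (intro op_norm_le) auto
  show "scale_fun (scale_fun (*)) c T \<in> L" by (rule mem[OF assms])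
  show "N (scale_fun (scale_fun (*)) c T) = norm c * N T"
  proof (cases "c = 0")
    case True
    then show ?thesis using le[OF assms, of c] op_norm_nonneg[OF mem[OF assms]] by (simp add: antisym)
  next
    case False
    have "N T = N (scale_fun (scale_fun (*)) (inverse c) (scale_fun (scale_fun (*)) c T))"
      using False by (simp add: scale_fun_def flip: mult.assoc)
    also have "\<dots> \<le> inverse (norm c) * N (scale_fun (scale_fun (*)) c T)"
      using le[OF mem[OF assms], of "inverse c"] by (simp add: norm_inverse)
    finally have "norm c * N T \<le> N (scale_fun (scale_fun (*)) c T)"
      using False by (simp add: field_simps)
    with le[OF assms] show ?thesis by (rule antisym)
  qed
qed

lemma vector_space_ops: "vector_space (scale_fun (scale_fun (*)) :: 'k \<Rightarrow> ('a \<Rightarrow> nat \<Rightarrow> 'k) \<Rightarrow> 'a \<Rightarrow> nat \<Rightarrow> 'k)"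
  by (intro vector_space_scale_fun vector_space_mult)

text \<open>This makes the duality lemmas and the M-ideal criterion available for operators into the
  sequence space.\<close>

sublocale op: normed_on "scale_fun (scale_fun (*))" N L
proof -
  interpret ops: vector_space "scale_fun (scale_fun (*)) :: 'k \<Rightarrow> ('a \<Rightarrow> nat \<Rightarrow> 'k) \<Rightarrow> 'a \<Rightarrow> nat \<Rightarrow> 'k"
    by (rule vector_space_ops)
  show "normed_on (scale_fun (scale_fun (*))) N L"
  proof (intro normed_on.intro vector_space_ops normed_on_axioms.intro)
    have "0 \<in> L"
      by (rule LI[where C = 0]) (use p_pos in \<open>auto simp: scale_fun_def fun_eq_iff\<close>)
    then show "ops.subspace L"
      by (intro ops.subspaceI) (auto simp: L_plus L_scale_fun)
    fix T assume T: "T \<in> L"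
    show "0 \<le> N T" by (rule op_norm_nonneg[OF T])
    show "N (scale_fun (scale_fun (*)) c T) = norm c * N T" for c by (rule L_scale_fun(2)[OF T])
    show "N (T + S) \<le> N T + N S" if "S \<in> L" for S by (rule L_plus(2)[OF T that])
    show "T = 0" if "N T = 0"
    proof
      fix x
      have "lp_norm p (T x) = 0" using op_norm_bound[OF T, of x] that by (simp add: antisym)
      then show "T x = 0 x" using lp_norm_eq_0[OF p_pos L_lp[OF T]] by simp
    qed
  qed
qed

lemma op_norm_minus:
  assumes "S \<in> L" "T \<in> L"
  shows "N (S - T) \<le> N S + N T" "N (S - T) = N (T - S)"
proof -
  have scale: "scale_fun (scale_fun (*)) (-1) T = - T" for T :: "'a \<Rightarrow> nat \<Rightarrow> 'k"
    by (simp add: scale_fun_def fun_eq_iff)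
  have neg: "- T \<in> L" "N (- T) = N T" if "T \<in> L" for T
    using L_scale_fun[OF that, of "-1"] by (simp_all add: scale)
  show "N (S - T) \<le> N S + N T"
    using L_plus(2)[OF assms(1) neg(1)[OF assms(2)]] neg(2)[OF assms(2)] by simp
  show "N (S - T) = N (T - S)"
    using neg(2)[OF op.E_diff[OF assms]] by simp
qed

section \<open>Compactness of operators and truncation of the range\<close>

definition op_head :: "nat \<Rightarrow> ('a \<Rightarrow> nat \<Rightarrow> 'k) \<Rightarrow> 'a \<Rightarrow> nat \<Rightarrow> 'k" where
  "op_head n T = (\<lambda>x. lp_head n (T x))"

lemma op_head_L:
  assumes "T \<in> L"
  shows "op_head n T \<in> L"
proof (rule LI[where C = "N T"])
  show "lp_norm p (op_head n T x) \<le> N T * norm x" for x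
    using lp_norm_head_le[OF p_pos L_lp[OF assms], of n x] op_norm_bound[OF assms, of x]
    by (simp add: op_head_def)
qed (simp_all only: op_head_def L_add[OF assms] lp_head_add L_scale[OF assms] lp_head_scale lp_head_in_lp[OF p_pos])

lemma op_tail_L: "T \<in> L \<Longrightarrow> T - op_head n T \<in> L"
  by (rule op.E_diff[OF _ op_head_L])

lemma op_norm_tail_le:
  assumes "T \<in> L"
  shows "N (T - op_head n T) \<le> N T"
  using lp_norm_tail_le[OF p_pos L_lp[OF assms]] op_norm_bound[OF assms]
  by (intro op_norm_le op_norm_nonneg[OF assms]) (auto simp: op_head_def intro: order_trans)

lemma op_head_plus: "op_head n (S + T) = op_head n S + op_head n T"
  and op_head_minus: "op_head n (S - T) = op_head n S - op_head n T"
  and op_head_scale: "op_head n (scale_fun (scale_fun (*)) c T) = scale_fun (scale_fun (*)) c (op_head n T)"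
  by (auto simp: op_head_def scale_fun_def fun_eq_iff lp_head_def)

text \<open>By completeness, compact closure of the image of the ball means total boundedness, which
  has a description by Cauchy subsequences. In this form no limit in the sequence space has to be
  exhibited.\<close>

lemma compact_iff_subseq:
  assumes T: "T \<in> L"
  shows "T \<in> lp_compact_ops scale p \<longleftrightarrow> (\<forall>x::nat \<Rightarrow> 'a. (\<forall>n. norm (x n) \<le> 1) \<longrightarrow>
    (\<exists>r. strict_mono r \<and> lp.MCauchy (\<lambda>n. T (x (r n)))))" (is "_ \<longleftrightarrow> ?R")
proof -
  have sub: "T ` cball 0 1 \<subseteq> lp p" using L_lp[OF T] by blast
  have "T \<in> lp_compact_ops scale p \<longleftrightarrow> lp.mtotally_bounded (T ` cball 0 1)"
    using T sub lp.mtotally_bounded_eq_compact_closure_of[OF mcomplete_lp[OF p]]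
    by (simp add: lp_compact_ops_def lp_topology_def)
  also have "\<dots> \<longleftrightarrow> ?R"
    unfolding lp.mtotally_bounded_sequentially
  proof (intro iffI conjI allI impI sub)
    fix x :: "nat \<Rightarrow> 'a" assume *: "T ` cball 0 1 \<subseteq> lp p \<and> (\<forall>\<sigma>::nat \<Rightarrow> nat \<Rightarrow> 'k. range \<sigma> \<subseteq> T ` cball 0 1
        \<longrightarrow> (\<exists>r. strict_mono r \<and> lp.MCauchy (\<sigma> \<circ> r)))" and x: "\<forall>n. norm (x n) \<le> 1"
    have "range (T \<circ> x) \<subseteq> T ` cball 0 1" using x by auto
    then have "\<exists>r. strict_mono r \<and> lp.MCauchy ((T \<circ> x) \<circ> r)" using * by blast
    then show "\<exists>r. strict_mono r \<and> lp.MCauchy (\<lambda>n. T (x (r n)))" by (simp add: comp_def)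
  next
    fix \<sigma> :: "nat \<Rightarrow> nat \<Rightarrow> 'k" assume R: ?R and \<sigma>: "range \<sigma> \<subseteq> T ` cball 0 1"
    have "\<forall>n. \<exists>x. norm x \<le> 1 \<and> \<sigma> n = T x" using \<sigma> by force
    then obtain x :: "nat \<Rightarrow> 'a" where x: "\<forall>n. norm (x n) \<le> 1 \<and> \<sigma> n = T (x n)"
      by (auto dest!: choice)
    then have "\<sigma> = (\<lambda>n. T (x n))" by auto
    then show "\<exists>r. strict_mono r \<and> lp.MCauchy (\<sigma> \<circ> r)" using R x by (simp add: comp_def)
  qed
  finally show ?thesis .
qed

text \<open>The tails of the finitely many centres of a net are uniformly small, and contractivity
  of tails carries this over to the whole image of the ball.\<close>

lemma compact_imp_tail:
  assumes T: "T \<in> lp_compact_ops scale p"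
  shows "(\<lambda>n. N (T - op_head n T)) \<longlonglongrightarrow> 0"
proof (rule LIMSEQ_I)
  fix e :: real assume e: "0 < e"
  have TL: "T \<in> L" using T by (simp add: lp_compact_ops_def)
  have "lp.mtotally_bounded (T ` cball 0 1)"
    using T L_lp[OF TL] by (intro lp.compact_closure_of_imp_mtotally_bounded)
      (auto simp: lp_compact_ops_def lp_topology_def)
  \<comment> \<open>One third of \<open>e\<close> goes to the tails of the centres and one to the
    distance from the net; the nonstrict bound \<open>2 * e / 3\<close> is then still below
    \<open>e\<close>.\<close>
  then obtain F where F: "finite F" "F \<subseteq> T ` cball 0 1" "T ` cball 0 1 \<subseteq> (\<Union>a\<in>F. lp.mball a (e / 3))"
    using e unfolding lp.mtotally_bounded_def by (meson zero_less_divide_iff zero_less_numeral)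
  have "\<forall>\<^sub>F n in sequentially. \<forall>a\<in>F. lp_norm p (a - lp_head n a) < e / 3"
  proof (rule eventually_ball_finite[OF F(1)], rule ballI)
    fix a assume "a \<in> F"
    then have "a \<in> lp p" using F(2) L_lp[OF TL] by blast
    then show "\<forall>\<^sub>F n in sequentially. lp_norm p (a - lp_head n a) < e / 3"
      using e by (intro order_tendstoD(2)[OF lp_tail_tendsto_0[OF p_pos]]) auto
  qed
  then obtain n0 where n0: "\<And>n a. n0 \<le> n \<Longrightarrow> a \<in> F \<Longrightarrow> lp_norm p (a - lp_head n a) < e / 3"
    unfolding eventually_sequentially by blast
  have "N (T - op_head n T) \<le> 2 * e / 3" if "n0 \<le> n" for n
  proof (rule op_norm_le_ball[OF op_tail_L[OF TL]])
    fix x :: 'a assume "norm x \<le> 1"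
    then have "T x \<in> T ` cball 0 1" by simp
    then obtain a where a: "a \<in> F" "T x \<in> lp.mball a (e / 3)" using F(3) by blast
    then have alp: "a \<in> lp p" and "lp_norm p (a - T x) < e / 3" by auto
    then have d: "lp_norm p (T x - a) < e / 3" "T x - a \<in> lp p"
      using lp.commute lp_diff'(1)[OF L_lp[OF TL]] by auto
    have eq: "(T - op_head n T) x = (a - lp_head n a) + ((T x - a) - lp_head n (T x - a))"
      by (simp add: op_head_def lp_head_diff)
    have "lp_norm p ((T - op_head n T) x) \<le> lp_norm p (a - lp_head n a) + lp_norm p ((T x - a) - lp_head n (T x - a))"
      unfolding eq by (intro lp_add'(2) lp_diff'(1) alp d(2) lp_head_in_lp p_pos)
    also have "\<dots> \<le> e / 3 + e / 3"
      using n0[OF that a(1)] lp_norm_tail_le[OF p_pos d(2), of n] d(1) by linarith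
    finally show "lp_norm p ((T - op_head n T) x) \<le> 2 * e / 3" by simp
  qed (use e in simp)
  then have "N (T - op_head n T) < e" if "n0 \<le> n" for n
    using that e by fastforce
  then show "\<exists>n0. \<forall>n\<ge>n0. norm (N (T - op_head n T) - 0) < e"
    using op_norm_nonneg[OF op_tail_L[OF TL]] by auto
qed

text \<open>A subsequence of the images converges in every coordinate, and uniformly small tails
  make it Cauchy in norm.\<close>

lemma tail_imp_compact:
  assumes T: "T \<in> L" and tail: "(\<lambda>n. N (T - op_head n T)) \<longlonglongrightarrow> 0"
  shows "T \<in> lp_compact_ops scale p"
  unfolding compact_iff_subseq[OF T]
proof (intro allI impI)
  fix x :: "nat \<Rightarrow> 'a" assume x: "\<forall>n. norm (x n) \<le> 1"
  \<comment> \<open>Sequential compactness of this countable product of scalar balls takes the place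
    of a diagonal argument.\<close>
  let ?U = "PiE UNIV (\<lambda>i::nat. cball (0::'k) (N T))"
  have "compactin (product_topology (\<lambda>i. euclidean) UNIV) ?U"
    unfolding compactin_PiE by auto
  then have "seq_compact ?U"
    by (simp add: euclidean_product_topology compact_imp_seq_compact)
  moreover have "norm (T (x n) i) \<le> N T" for n i
    using norm_le_lp_norm[OF p_pos L_lp[OF T], of "x n" i] op_norm_ball[OF T] x order_trans by blast
  then have "\<forall>n. T (x n) \<in> ?U" by auto
  ultimately obtain y r where r: "strict_mono r" and y: "((\<lambda>n. T (x n)) \<circ> r) \<longlonglongrightarrow> y"
    by (rule seq_compactE)
  have yi: "(\<lambda>n. T (x (r n)) i) \<longlonglongrightarrow> y i" for i
  proof -
    have "continuous_on UNIV (\<lambda>f :: nat \<Rightarrow> 'k. f i)"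
      by (rule continuous_on_product_coordinates)
    then have "((\<lambda>f. f i) \<longlongrightarrow> y i) (at y)" by (simp add: continuous_on_def)
    from tendsto_compose[OF this y] show ?thesis by (simp add: comp_def)
  qed
  have "\<exists>M. \<forall>j k. M \<le> j \<longrightarrow> M \<le> k \<longrightarrow> lp_norm p (T (x (r j)) - T (x (r k))) < e" if e: "0 < e" for e
  proof -
    \<comment> \<open>The head of a difference costs \<open>e / 4\<close> for each of the two
      indices. The tail costs \<open>e / 4\<close> times 2, the bound for the distance of two points
      of the unit ball.\<close>
    have "\<forall>\<^sub>F n in sequentially. N (T - op_head n T) < e / 4"
      using e by (intro order_tendstoD(2)[OF tail]) auto
    then obtain n where n: "N (T - op_head n T) < e / 4"
      by (auto simp: eventually_sequentially)
    have "(\<lambda>j. \<Sum>i<n. norm (T (x (r j)) i - y i)) \<longlonglongrightarrow> (\<Sum>i<n. 0)"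
      by (intro tendsto_sum tendsto_norm_zero LIM_zero yi)
    then have "\<forall>\<^sub>F j in sequentially. (\<Sum>i<n. norm (T (x (r j)) i - y i)) < e / 4"
      by (rule order_tendstoD) (use e in simp)
    then obtain M where M: "\<And>j. M \<le> j \<Longrightarrow> (\<Sum>i<n. norm (T (x (r j)) i - y i)) < e / 4"
      by (auto simp: eventually_sequentially)
    have "lp_norm p (T (x (r j)) - T (x (r k))) < e" if jk: "M \<le> j" "M \<le> k" for j k
    proof -
      let ?d = "T (x (r j) - x (r k))"
      have d: "?d = T (x (r j)) - T (x (r k))" by (rule L_diff[OF T])
      have "lp_norm p (lp_head n ?d) \<le> (\<Sum>i<n. norm (?d i))"
        by (rule lp_norm_head_le_sum[OF p])
      also have "\<dots> \<le> (\<Sum>i<n. norm (T (x (r j)) i - y i) + norm (T (x (r k)) i - y i))"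
        unfolding d minus_apply
        by (intro sum_mono) (metis norm_triangle_ineq4 diff_diff_eq2 diff_add_cancel add_diff_cancel_right)
      also have "\<dots> < e / 4 + e / 4"
        unfolding sum.distrib using M[OF jk(1)] M[OF jk(2)] by (rule add_strict_mono)
      finally have head: "lp_norm p (lp_head n ?d) < e / 2" by simp
      have "lp_norm p ((T - op_head n T) (x (r j) - x (r k))) \<le> N (T - op_head n T) * norm (x (r j) - x (r k))"
        by (rule op_norm_bound[OF op_tail_L[OF T]])
      also have "\<dots> \<le> e / 4 * 2"
      proof (rule mult_mono)
        show "norm (x (r j) - x (r k)) \<le> 2"
          using norm_triangle_ineq4[of "x (r j)" "x (r k)"] x[rule_format, of "r j"] x[rule_format, of "r k"]
          by linarith
      qed (use n e in auto)
      finally have tl: "lp_norm p ((T - op_head n T) (x (r j) - x (r k))) \<le> e / 2" by simp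
      have "lp_norm p (lp_head n ?d + (T - op_head n T) (x (r j) - x (r k)))
          \<le> lp_norm p (lp_head n ?d) + lp_norm p ((T - op_head n T) (x (r j) - x (r k)))"
        by (intro lp_add'(2) lp_head_in_lp p_pos L_lp op_tail_L T)
      moreover have "lp_head n ?d + (T - op_head n T) (x (r j) - x (r k)) = ?d"
        by (simp add: op_head_def)
      ultimately have "lp_norm p ?d \<le> lp_norm p (lp_head n ?d) + lp_norm p ((T - op_head n T) (x (r j) - x (r k)))"
        by (simp only:)
      then show ?thesis using head tl d by simp
    qed
    then show ?thesis by blast
  qed
  then have "lp.MCauchy (\<lambda>n. T (x (r n)))"
    unfolding lp.MCauchy_def using L_lp[OF T] by auto
  with r show "\<exists>r. strict_mono r \<and> lp.MCauchy (\<lambda>n. T (x (r n)))" by blast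
qed

lemma compact_L: "T \<in> lp_compact_ops scale p \<Longrightarrow> T \<in> L"
  by (simp add: lp_compact_ops_def)

text \<open>Since compactness amounts to tails tending to 0 in operator norm, each closure property
  becomes a statement about null sequences.\<close>

lemma closed_subspace_compact:
  "closed_subspace_on (scale_fun (scale_fun (*))) N L (lp_compact_ops scale p)"
  unfolding closed_subspace_on_def
proof (intro conjI allI impI)
  show "lp_compact_ops scale p \<subseteq> L" using compact_L by blast
  show "op.subspace (lp_compact_ops scale p)"
  proof (rule op.subspaceI)
    have "op_head n 0 = 0" for n by (simp add: op_head_def fun_eq_iff lp_head_def)
    then show "0 \<in> lp_compact_ops scale p"
      using op.zero_in_E op.N_0 by (intro tail_imp_compact) auto
    fix S T c assume S: "S \<in> lp_compact_ops scale p"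
    note SL = compact_L[OF S]
    have "scale_fun (scale_fun (*)) c S - op_head n (scale_fun (scale_fun (*)) c S)
        = scale_fun (scale_fun (*)) c (S - op_head n S)" for n
      by (simp add: op_head_scale op.scale_right_diff_distrib)
    then have "N (scale_fun (scale_fun (*)) c S - op_head n (scale_fun (scale_fun (*)) c S))
        = norm c * N (S - op_head n S)" for n
      using op.N_scale[OF op_tail_L[OF SL]] by simp
    then show "scale_fun (scale_fun (*)) c S \<in> lp_compact_ops scale p"
      using tendsto_mult_left[OF compact_imp_tail[OF S], of "norm c"] L_scale_fun(1)[OF SL]
      by (intro tail_imp_compact) auto
    assume T: "T \<in> lp_compact_ops scale p"
    note TL = compact_L[OF T]
    show "S + T \<in> lp_compact_ops scale p"
    proof (rule tail_imp_compact[OF L_plus(1)[OF SL TL]])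
      have "norm (N (S + T - op_head n (S + T))) \<le> N (S - op_head n S) + N (T - op_head n T)" for n
        using L_plus(2)[OF op_tail_L[OF SL, of n] op_tail_L[OF TL, of n]]
          op_norm_nonneg[OF op_tail_L[OF L_plus(1)[OF SL TL]], of n]
        by (simp add: op_head_plus algebra_simps)
      moreover have "(\<lambda>n. N (S - op_head n S) + N (T - op_head n T)) \<longlonglongrightarrow> 0"
        using tendsto_add[OF compact_imp_tail[OF S] compact_imp_tail[OF T]] by simp
      ultimately show "(\<lambda>n. N (S + T - op_head n (S + T))) \<longlonglongrightarrow> 0"
        by (rule Lim_null_comparison[OF always_eventually[OF allI]])
    qed
  qed
  fix u T assume u: "range u \<subseteq> lp_compact_ops scale p" and T: "T \<in> L"
    and conv: "(\<lambda>n. N (u n - T)) \<longlonglongrightarrow> 0"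
  have uK: "u n \<in> lp_compact_ops scale p" for n using u by blast
  show "T \<in> lp_compact_ops scale p"
  proof (rule tail_imp_compact[OF T], rule LIMSEQ_I)
    fix e :: real assume e: "0 < e"
    obtain k where k: "N (u k - T) < e / 2"
      using order_tendstoD(2)[OF conv, of "e / 2"] e by (auto simp: eventually_sequentially)
    obtain n0 where n0: "\<And>n. n0 \<le> n \<Longrightarrow> N (u k - op_head n (u k)) < e / 2"
      using order_tendstoD(2)[OF compact_imp_tail[OF uK[of k]], of "e / 2"] e
      by (auto simp: eventually_sequentially)
    have "N (T - op_head n T) < e" if "n0 \<le> n" for n
    proof -
      let ?v = "u k - T"
      have v: "?v \<in> L" by (rule op.E_diff[OF compact_L[OF uK] T])
      \<comment> \<open>The tail of the limit is the tail of an approximant minus the tail of the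
        small difference \<open>?v\<close>, and passing to tails does not increase the norm.\<close>
      have eq: "T - op_head n T = (u k - op_head n (u k)) - (?v - op_head n ?v)"
        by (simp add: op_head_minus)
      have "N (T - op_head n T) \<le> N (u k - op_head n (u k)) + N (?v - op_head n ?v)"
        unfolding eq by (rule op_norm_minus(1)[OF op_tail_L[OF compact_L[OF uK]] op_tail_L[OF v]])
      also have "\<dots> < e / 2 + e / 2"
        using n0[OF that] op_norm_tail_le[OF v, of n] k by linarith
      finally show ?thesis by simp
    qed
    then show "\<exists>n0. \<forall>n\<ge>n0. norm (N (T - op_head n T) - 0) < e"
      using op_norm_nonneg[OF op_tail_L[OF T]] by auto
  qed
qed

section \<open>Composition with operators on the domain\<close>

lemma L_compose:
  assumes T: "T \<in> L" and A: "A \<in> linear_ops scale scale"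
  shows "(\<lambda>x. T (A x)) \<in> L" "N (\<lambda>x. T (A x)) \<le> N T * onorm A"
proof -
  have bl: "bounded_linear A" and sc: "A (scale c x) = scale c (A x)" for c x
    using A by (auto simp: linear_ops_def)
  interpret A: bounded_linear A by (rule bl)
  have *: "lp_norm p (T (A x)) \<le> (N T * onorm A) * norm x" for x
    using op_norm_bound[OF T, of "A x"] mult_left_mono[OF onorm[OF bl, of x] op_norm_nonneg[OF T]]
    by (simp add: mult.assoc)
  show "(\<lambda>x. T (A x)) \<in> L"
    by (rule LI[OF _ _ _ *]) (simp_all add: L_lp[OF T] A.add L_add[OF T] sc L_scale[OF T])
  show "N (\<lambda>x. T (A x)) \<le> N T * onorm A"
    by (rule op_norm_le[OF _ *]) (simp add: op_norm_nonneg[OF T] onorm_pos_le[OF bl])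
qed

lemma compact_compose:
  assumes T: "T \<in> L" and A: "A \<in> compact_ops scale scale"
  shows "(\<lambda>x. T (A x)) \<in> lp_compact_ops scale p"
proof -
  have A': "A \<in> linear_ops scale scale" using A by (simp add: compact_ops_def)
  show ?thesis
    unfolding compact_iff_subseq[OF L_compose(1)[OF T A']]
  proof (intro allI impI)
    fix x :: "nat \<Rightarrow> 'a" assume x: "\<forall>n. norm (x n) \<le> 1"
    have "seq_compact (closure (A ` cball 0 1))"
      using A by (simp add: compact_ops_def compact_imp_seq_compact)
    moreover have "\<forall>n. A (x n) \<in> closure (A ` cball 0 1)"
      using x closure_subset[of "A ` cball 0 1"] by auto
    ultimately obtain z r where r: "strict_mono r" and z: "((\<lambda>n. A (x n)) \<circ> r) \<longlonglongrightarrow> z"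
      by (rule seq_compactE)
    have "Cauchy (\<lambda>n. A (x (r n)))"
      using LIMSEQ_imp_Cauchy[OF z] by (simp add: comp_def)
    have "\<exists>M. \<forall>j k. M \<le> j \<longrightarrow> M \<le> k \<longrightarrow> lp_norm p (T (A (x (r j))) - T (A (x (r k)))) < e" if e: "0 < e" for e
    proof -
      \<comment> \<open>Adding 1 keeps the denominator positive when \<open>T\<close> is 0.\<close>
      have "0 < e / (N T + 1)" using e op_norm_nonneg[OF T] by simp
      then obtain M where M: "\<And>j k. M \<le> j \<Longrightarrow> M \<le> k \<Longrightarrow> norm (A (x (r j)) - A (x (r k))) < e / (N T + 1)"
        using \<open>Cauchy _\<close> unfolding Cauchy_iff by blast
      have "lp_norm p (T (A (x (r j))) - T (A (x (r k)))) < e" if "M \<le> j" "M \<le> k" for j k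
      proof -
        have "lp_norm p (T (A (x (r j))) - T (A (x (r k)))) \<le> N T * norm (A (x (r j)) - A (x (r k)))"
          using op_norm_bound[OF T, of "A (x (r j)) - A (x (r k))"] by (simp add: L_diff[OF T])
        also have "\<dots> \<le> (N T + 1) * norm (A (x (r j)) - A (x (r k)))"
          by (intro mult_right_mono) auto
        also have "\<dots> < e"
          using M[OF that] op_norm_nonneg[OF T] by (simp add: field_simps)
        finally show ?thesis .
      qed
      then show ?thesis by blast
    qed
    then have "lp.MCauchy (\<lambda>n. T (A (x (r n))))"
      unfolding lp.MCauchy_def using L_lp[OF T] by auto
    with r show "\<exists>r. strict_mono r \<and> lp.MCauchy (\<lambda>n. T (A (x (r n))))" by blast
  qed
qed

text \<open>Coordinates of an operator are functionals on the domain; through them the norm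
  convergence of the adjoints of \<open>K n\<close> acts on operators.\<close>

lemma coordinate_dual:
  assumes "T \<in> L"
  shows "(\<lambda>x. T x i) \<in> dual scale"
  unfolding dual_def linear_ops_def
proof (intro CollectI conjI allI bounded_linear_intro)
  show "T (scale c x) i = c * T x i" for c x
    by (simp add: L_scale[OF assms] scale_fun_def)
  \<comment> \<open>Real multiples are multiples by \<open>of_real r\<close>, so real homogeneity
    follows from homogeneity over the scalar field.\<close>
  show "T (r *\<^sub>R x) i = r *\<^sub>R T x i" for r x
    using L_scale[OF assms, of "of_real r" x] by (simp add: scale_of_real scale_fun_def scaleR_conv_of_real)
  show "norm (T x i) \<le> norm x * N T" for x
    using norm_le_lp_norm[OF p_pos L_lp[OF assms], of x i] op_norm_bound[OF assms, of x] by (simp add: mult.commute)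
qed (simp add: L_add[OF assms])

text \<open>Only \<open>k\<close> coordinate functionals are involved, and by \<open>b\<close> each
  composed with \<open>K n\<close> converges to itself in dual norm.\<close>

lemma op_head_tendsto_0:
  assumes T: "T \<in> L" and K: "\<And>n. K n \<in> linear_ops scale scale"
    and b: "\<And>f. f \<in> dual scale \<Longrightarrow> (\<lambda>n. onorm (\<lambda>x. f (K n x) - f x)) \<longlonglongrightarrow> 0"
  shows "(\<lambda>n. N (op_head k (\<lambda>x. T (K n x)) - op_head k T)) \<longlonglongrightarrow> 0"
proof -
  have bl: "bounded_linear (\<lambda>x. T (K n x) i - T x i)" for n i
    using coordinate_dual[OF T, of i] K[of n] unfolding dual_def linear_ops_def
    by (auto intro!: bounded_linear_sub bounded_linear_compose[of "\<lambda>x. T x i" "K n"])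
  have L: "op_head k (\<lambda>x. T (K n x)) - op_head k T \<in> L" for n
    using L_compose(1)[OF T K] T by (intro op.E_diff op_head_L)
  have "N (op_head k (\<lambda>x. T (K n x)) - op_head k T) \<le> (\<Sum>i<k. onorm (\<lambda>x. T (K n x) i - T x i))" for n
  proof (rule op_norm_le)
    fix x
    have "lp_norm p ((op_head k (\<lambda>x. T (K n x)) - op_head k T) x) = lp_norm p (lp_head k (T (K n x) - T x))"
      by (simp add: op_head_def lp_head_diff)
    also have "\<dots> \<le> (\<Sum>i<k. norm (T (K n x) i - T x i))"
      using lp_norm_head_le_sum[OF p, of k "T (K n x) - T x"] by simp
    also have "\<dots> \<le> (\<Sum>i<k. onorm (\<lambda>x. T (K n x) i - T x i) * norm x)"
      by (intro sum_mono onorm[OF bl])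
    finally show "lp_norm p ((op_head k (\<lambda>x. T (K n x)) - op_head k T) x)
        \<le> (\<Sum>i<k. onorm (\<lambda>x. T (K n x) i - T x i)) * norm x"
      by (simp add: sum_distrib_right)
  qed (intro sum_nonneg onorm_pos_le[OF bl])
  then have "norm (N (op_head k (\<lambda>x. T (K n x)) - op_head k T)) \<le> (\<Sum>i<k. onorm (\<lambda>x. T (K n x) i - T x i))" for n
    using op_norm_nonneg[OF L] by simp
  moreover have "(\<lambda>n. \<Sum>i<k. onorm (\<lambda>x. T (K n x) i - T x i)) \<longlonglongrightarrow> 0"
    using tendsto_sum[OF b[OF coordinate_dual[OF T]], where I = "{..<k}"] by simp
  ultimately show ?thesis
    by (rule Lim_null_comparison[OF always_eventually[OF allI]])
qed

end

section \<open>The estimate on the domain\<close>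

text \<open>The order of the quantifiers matters: compactness of the single operator
  \<open>K l\<close> produces the limit \<open>z\<close>, and only then does \<open>m\<close> tend
  to infinity to produce a weakly null sequence. Arguing by contradiction makes the bound uniform
  over the unit ball.\<close>

lemma basic_inequality_uniform:
  fixes scale :: "'k::{real_normed_field,euclidean_space} \<Rightarrow> 'a::banach \<Rightarrow> 'a"
    and K :: "nat \<Rightarrow> 'a \<Rightarrow> 'a"
  assumes p: "1 < p"
    and K: "\<And>n. K n \<in> compact_ops scale scale"
    and a: "\<And>x. (\<lambda>n. K n x) \<longlonglongrightarrow> x"
    and b: "\<And>f. f \<in> dual scale \<Longrightarrow> (\<lambda>n. onorm (\<lambda>x. f (K n x) - f x)) \<longlonglongrightarrow> 0"
    and c: "(\<lambda>n. onorm (\<lambda>x. x - 2 *\<^sub>R K n x)) \<longlonglongrightarrow> 1"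
    and basic: "\<And>x xs. weakly_null scale xs \<Longrightarrow>
      limsup (\<lambda>n. ereal ((norm x powr p + norm (xs n) powr p) powr (1 / p)))
      \<le> limsup (\<lambda>n. ereal (((norm (x + xs n) powr p + norm (x - xs n) powr p) / 2) powr (1 / p)))"
    and C: "1 < C"
  shows "\<forall>\<^sub>F l in sequentially. \<forall>\<^sub>F m in sequentially.
    \<forall>x. norm x \<le> 1 \<longrightarrow> norm (K l x) powr p + norm (x - K m x) powr p \<le> C"
proof -
  have bl: "bounded_linear (K n)" for n
    using K[of n] by (simp add: compact_ops_def linear_ops_def)
  \<comment> \<open>The constants leave room on both sides: \<open>B powr p = sqrt C\<close> is
    below \<open>C\<close>, while \<open>d\<close> and \<open>(1 + d * d) / 2\<close>, the
    asymptotic bounds for \<open>z - y\<close> and \<open>z + y\<close>, are below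
    \<open>B\<close>.\<close>
  define B where "B = C powr (1 / (2 * p))"
  define d where "d = sqrt B"
  have B: "1 < B" using C p by (simp add: B_def)
  have d: "1 < d" "d < B" "d * d = B"
    using B real_sqrt_less_mono[of B "B * B"] by (auto simp: d_def)
  have Bp: "B powr p = sqrt C"
    using C p by (simp add: B_def powr_powr powr_half_sqrt)
  define good where "good n \<longleftrightarrow> (\<forall>x. norm (x - 2 *\<^sub>R K n x) \<le> d * norm x)" for n
  have "\<forall>\<^sub>F n in sequentially. onorm (\<lambda>x. x - 2 *\<^sub>R K n x) < d"
    using c d(1) by (rule order_tendstoD)
  then have good: "\<forall>\<^sub>F n in sequentially. good n"
  proof (rule eventually_mono)
    fix n assume n: "onorm (\<lambda>x. x - 2 *\<^sub>R K n x) < d"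
    have "bounded_linear (\<lambda>x. x - 2 *\<^sub>R K n x)"
      by (intro bounded_linear_sub bounded_linear_ident bounded_linear_scaleR_right
          bounded_linear_compose[OF bounded_linear_scaleR_right bl])
    then show "good n"
      unfolding good_def using onorm n
      by (meson less_imp_le mult_right_mono norm_ge_zero order_trans)
  qed
  \<comment> \<open>The operator \<open>K n\<close> is half the difference of \<open>Id\<close> and
    \<open>Id - 2 K n\<close>.\<close>
  have goodD: "norm (K n x) \<le> (1 + d) / 2 * norm x" if "good n" for n x
  proof -
    have "norm (2 *\<^sub>R K n x) \<le> norm x + norm (x - 2 *\<^sub>R K n x)"
      using norm_triangle_ineq4[of x "x - 2 *\<^sub>R K n x"] by simp
    then show ?thesis using that by (simp add: good_def field_simps) (smt (verit))
  qed
  show ?thesis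
    using good
  proof (rule eventually_mono)
    fix l assume l: "good l"
    let ?Q = "\<lambda>m. \<forall>x. norm x \<le> 1 \<longrightarrow> norm (K l x) powr p + norm (x - K m x) powr p \<le> C"
    show "\<forall>\<^sub>F m in sequentially. ?Q m"
    proof (rule ccontr)
      assume "\<not> ?thesis"
      from not_eventually_sequentiallyD[OF this]
      obtain r0 :: "nat \<Rightarrow> nat" where r0: "strict_mono r0" "\<And>j. \<not> ?Q (r0 j)"
        by blast
      then have "\<forall>j. \<exists>x. norm x \<le> 1 \<and> C < norm (K l x) powr p + norm (x - K (r0 j) x) powr p"
        by (auto simp: not_le)
      then obtain x :: "nat \<Rightarrow> 'a" where x: "\<And>j. norm (x j) \<le> 1"
        "\<And>j. C < norm (K l (x j)) powr p + norm (x j - K (r0 j) (x j)) powr p"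
        by (auto dest!: choice)
      have "seq_compact (closure (K l ` cball 0 1))"
        using K[of l] by (simp add: compact_ops_def compact_imp_seq_compact)
      moreover have "\<forall>j. K l (x j) \<in> closure (K l ` cball 0 1)"
        using x(1) closure_subset[of "K l ` cball 0 1"] by auto
      ultimately obtain z r1 where r1: "strict_mono r1" and z: "((\<lambda>j. K l (x j)) \<circ> r1) \<longlonglongrightarrow> z"
        by (rule seq_compactE)
      define w where "w j = x (r1 j)" for j
      define m where "m j = r0 (r1 j)" for j
      define y where "y j = w j - K (m j) (w j)" for j
      have w: "norm (w j) \<le> 1" and bad: "C < norm (K l (w j)) powr p + norm (y j) powr p" for j
        using x by (auto simp: w_def y_def m_def)
      have m: "filterlim m sequentially sequentially"
        using filterlim_subseq[OF strict_mono_o[OF r0(1) r1]] by (simp add: m_def[abs_def] comp_def)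
      have weak: "weakly_null scale y"
        unfolding weakly_null_def
      proof
        fix f assume f: "f \<in> dual scale"
        then have fl: "bounded_linear f" by (simp add: dual_def linear_ops_def)
        interpret f: bounded_linear f by (rule fl)
        \<comment> \<open>The vector \<open>y j\<close> is the image under
          \<open>Id - K (m j)\<close> of the unit ball element \<open>w j\<close>, so the adjoint
          convergence in \<open>b\<close> applies to \<open>f\<close>.\<close>
        have "norm (f (y j)) \<le> onorm (\<lambda>x. f (K (m j) x) - f x)" for j
        proof -
          have "bounded_linear (\<lambda>x. f (K (m j) x) - f x)"
            by (intro bounded_linear_sub fl bounded_linear_compose[OF fl bl])
          from onorm[OF this, of "w j"] onorm_pos_le[OF this] w[of j]
          have "norm (f (K (m j) (w j)) - f (w j)) \<le> onorm (\<lambda>x. f (K (m j) x) - f x)"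
            using mult_left_mono[of "norm (w j)" 1 "onorm (\<lambda>x. f (K (m j) x) - f x)"] by simp
          then show ?thesis by (simp add: y_def f.diff norm_minus_commute)
        qed
        moreover have "(\<lambda>j. onorm (\<lambda>x. f (K (m j) x) - f x)) \<longlonglongrightarrow> 0"
          using filterlim_compose[OF b[OF f] m] .
        ultimately show "(\<lambda>j. f (y j)) \<longlonglongrightarrow> 0"
          by (rule Lim_null_comparison[OF always_eventually[OF allI]])
      qed
      define e where "e j = norm (K l (w j) - z)" for j
      define h where "h j = norm (K (m j) z - z)" for j
      have e: "e \<longlonglongrightarrow> 0"
        using z LIM_zero[THEN tendsto_norm_zero] by (auto simp: e_def[abs_def] w_def comp_def)
      have h: "h \<longlonglongrightarrow> 0"
        unfolding h_def[abs_def]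
        by (intro tendsto_norm_zero LIM_zero filterlim_compose[OF a m])
      have plus: "norm (z + y j) \<le> (1 + d * d) / 2 + e j * (2 + d) + 2 * h j" if "good (m j)" for j
      proof -
        interpret K: bounded_linear "K (m j)" by (rule bl)
        \<comment> \<open>\<open>(Id - 2 K\<^sub>m) (Id - 2 K\<^sub>l)\<close> is close to \<open>Id - 2 K\<^sub>m + 2 K\<^sub>l\<close> at \<open>w\<close>, since \<open>K\<^sub>m z\<close> is close
          to \<open>z\<close>; averaging with \<open>Id\<close> bounds \<open>Id - K\<^sub>m + K\<^sub>l\<close>.\<close>
        define v where "v = (w j - 2 *\<^sub>R K l (w j)) - 2 *\<^sub>R K (m j) (w j - 2 *\<^sub>R K l (w j))"
        have "norm v \<le> d * norm (w j - 2 *\<^sub>R K l (w j))"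
          using that by (simp add: good_def v_def)
        also have "\<dots> \<le> d * (d * norm (w j))"
          using l d by (intro mult_left_mono) (auto simp: good_def)
        also have "\<dots> \<le> d * (d * 1)"
          using w d by (intro mult_left_mono) auto
        finally have v: "norm v \<le> d * d" by simp
        have Ke: "norm (K (m j) (K l (w j) - z)) \<le> (1 + d) / 2 * e j"
          unfolding e_def using goodD[OF that] .
        have four: "4 *\<^sub>R u = u + u + u + u" for u :: 'a
          using scaleR_left_distrib[of 2 2 u] by (simp add: scaleR_2)
        have "2 *\<^sub>R (z + y j) = w j + v + 2 *\<^sub>R (K l (w j) - z)
            - 4 *\<^sub>R K (m j) (K l (w j) - z) - 4 *\<^sub>R (K (m j) z - z)"
          by (simp add: v_def y_def K.diff K.add algebra_simps scaleR_2 four)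
        then have "norm (2 *\<^sub>R (z + y j)) \<le> norm (w j) + norm v + norm (2 *\<^sub>R (K l (w j) - z))
            + norm (4 *\<^sub>R K (m j) (K l (w j) - z)) + norm (4 *\<^sub>R (K (m j) z - z))"
          by (smt (verit) norm_triangle_ineq norm_triangle_ineq4)
        also have "\<dots> \<le> 1 + d * d + 2 * e j + 4 * ((1 + d) / 2 * e j) + 4 * h j"
          using w[of j] v Ke by (simp add: e_def h_def)
        finally have "2 * norm (z + y j) \<le> 1 + d * d + 2 * e j + 4 * ((1 + d) / 2 * e j) + 4 * h j"
          by (simp only: norm_scaleR)
        then show ?thesis by (simp add: field_simps)
      qed
      \<comment> \<open>The vector \<open>w - K m w - K l w\<close> is the average of the images of
        \<open>w\<close> under \<open>Id - 2 K m\<close> and \<open>Id - 2 K l\<close>, both of norm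
        at most \<open>d\<close>; it differs from \<open>y - z\<close> by an error
        \<open>e\<close>.\<close>
      have minus: "norm (z - y j) \<le> d + e j" if "good (m j)" for j
      proof -
        have "2 *\<^sub>R (y j - z) = (w j - 2 *\<^sub>R K (m j) (w j)) + (w j - 2 *\<^sub>R K l (w j)) + 2 *\<^sub>R (K l (w j) - z)"
          by (simp add: y_def algebra_simps scaleR_2)
        then have "norm (2 *\<^sub>R (y j - z)) \<le> norm (w j - 2 *\<^sub>R K (m j) (w j)) + norm (w j - 2 *\<^sub>R K l (w j))
            + norm (2 *\<^sub>R (K l (w j) - z))"
          by (smt (verit) norm_triangle_ineq)
        also have "\<dots> \<le> d * norm (w j) + d * norm (w j) + 2 * e j"
          using that l by (intro add_mono) (auto simp: good_def e_def)
        also have "\<dots> \<le> d * 1 + d * 1 + 2 * e j"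
          using w d by (intro add_mono mult_left_mono) auto
        finally show ?thesis by (simp add: norm_minus_commute)
      qed
      have good_m: "\<forall>\<^sub>F j in sequentially. good (m j)"
        using m good unfolding filterlim_iff by blast
      \<comment> \<open>Because \<open>d * d = B\<close>, the limit is \<open>(1 + B) / 2\<close>,
        which is below \<open>B\<close>.\<close>
      have "(\<lambda>j. (1 + d * d) / 2 + e j * (2 + d) + 2 * h j) \<longlonglongrightarrow> (1 + d * d) / 2 + 0 * (2 + d) + 2 * 0"
        by (intro tendsto_intros e h)
      then have ev1: "\<forall>\<^sub>F j in sequentially. (1 + d * d) / 2 + e j * (2 + d) + 2 * h j < B"
        by (rule order_tendstoD) (use B d in simp)
      have "(\<lambda>j. d + e j) \<longlonglongrightarrow> d + 0" by (intro tendsto_intros e)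
      then have ev2: "\<forall>\<^sub>F j in sequentially. d + e j < B"
        by (rule order_tendstoD) (use d in simp)
      have "\<forall>\<^sub>F j in sequentially.
          ereal (((norm (z + y j) powr p + norm (z - y j) powr p) / 2) powr (1 / p)) \<le> ereal B"
        using good_m ev1 ev2
      proof eventually_elim
        case (elim j)
        have "norm (z + y j) powr p \<le> B powr p" "norm (z - y j) powr p \<le> B powr p"
          using plus[OF elim(1)] minus[OF elim(1)] elim p by (auto intro!: powr_mono2)
        then have "((norm (z + y j) powr p + norm (z - y j) powr p) / 2) powr (1 / p) \<le> (B powr p) powr (1 / p)"
          using p by (intro powr_mono2) auto
        then show ?case using p B by (simp add: powr_powr)
      qed
      then have upper: "limsup (\<lambda>j. ereal (((norm (z + y j) powr p + norm (z - y j) powr p) / 2) powr (1 / p))) \<le> ereal B"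
        by (rule Limsup_bounded)
      \<comment> \<open>The midpoint of \<open>sqrt C\<close> and \<open>C\<close>: half of the gap
        absorbs the replacement of \<open>K l (w j)\<close> by \<open>z\<close>, and the other half
        gives the contradiction.\<close>
      define M where "M = (C + sqrt C) / 2"
      have sqC: "sqrt C < C" using C real_sqrt_less_mono[of C "C * C"] by auto
      have "(\<lambda>j. norm (K l (w j)) powr p) \<longlonglongrightarrow> norm z powr p"
        using z p by (intro tendsto_powr' tendsto_norm) (auto simp: w_def comp_def)
      then have "\<forall>\<^sub>F j in sequentially. norm (K l (w j)) powr p < norm z powr p + (C - sqrt C) / 2"
        by (rule order_tendstoD) (use sqC in simp)
      then have "\<forall>\<^sub>F j in sequentially. ereal (M powr (1 / p)) \<le> ereal ((norm z powr p + norm (y j) powr p) powr (1 / p))"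
      proof eventually_elim
        case (elim j)
        then have "M \<le> norm z powr p + norm (y j) powr p"
          using bad[of j] by (simp add: M_def field_simps)
        then show ?case using p C by (simp add: M_def powr_mono2)
      qed
      then have "ereal (M powr (1 / p)) \<le> limsup (\<lambda>j. ereal ((norm z powr p + norm (y j) powr p) powr (1 / p)))"
        by (rule le_Limsup[OF sequentially_bot])
      also note basic[OF weak]
      also note upper
      \<comment> \<open>This reads \<open>M \<le> sqrt C\<close>, whereas the midpoint
        \<open>M\<close> is strictly larger.\<close>
      finally have "(M powr (1 / p)) powr p \<le> B powr p"
        using p by (intro powr_mono2) auto
      then show False
        using Bp sqC p C by (simp add: powr_powr M_def)
    qed
  qed
qed

section \<open>The M-ideal property\<close>

context lp_operators
begin

text \<open>Split \<open>T\<close> into a head and a tail. The tail is small uniformly in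
  \<open>n\<close> because the \<open>K n\<close> are uniformly bounded, and the head converges
  through its finitely many coordinates.\<close>

lemma compact_compose_tendsto:
  assumes T: "T \<in> lp_compact_ops scale p" and K: "\<And>n. K n \<in> linear_ops scale scale"
    and b: "\<And>f. f \<in> dual scale \<Longrightarrow> (\<lambda>n. onorm (\<lambda>x. f (K n x) - f x)) \<longlonglongrightarrow> 0"
    and M: "\<And>n. onorm (K n) \<le> M"
  shows "(\<lambda>n. N ((\<lambda>x. T (K n x)) - T)) \<longlonglongrightarrow> 0"
proof (rule LIMSEQ_I)
  fix e :: real assume e: "0 < e"
  note TL = compact_L[OF T]
  have "0 \<le> onorm (K 0)" using K[of 0] by (intro onorm_pos_le) (simp add: linear_ops_def)
  then have M0: "0 \<le> M" using M[of 0] by linarith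
  \<comment> \<open>The factor has one share \<open>M\<close> for the tail composed with
    \<open>K n\<close> and one share 1 for the tail itself.\<close>
  have "(\<lambda>k. N (T - op_head k T) * (M + 1)) \<longlonglongrightarrow> 0"
    using tendsto_mult_right[OF compact_imp_tail[OF T], of "M + 1"] by simp
  then have "\<forall>\<^sub>F k in sequentially. N (T - op_head k T) * (M + 1) < e / 2"
    by (rule order_tendstoD) (rule half_gt_zero[OF e])
  then obtain k where k: "N (T - op_head k T) * (M + 1) < e / 2"
    by (auto simp: eventually_sequentially)
  have "\<forall>\<^sub>F n in sequentially. N (op_head k (\<lambda>x. T (K n x)) - op_head k T) < e / 2"
    by (rule order_tendstoD(2)[OF op_head_tendsto_0[OF TL K b] half_gt_zero[OF e]])
  then obtain n0 where n0: "\<And>n. n0 \<le> n \<Longrightarrow> N (op_head k (\<lambda>x. T (K n x)) - op_head k T) < e / 2"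
    by (auto simp: eventually_sequentially)
  have "N ((\<lambda>x. T (K n x)) - T) < e" if "n0 \<le> n" for n
  proof -
    let ?R = "T - op_head k T"
    note RL = op_tail_L[OF TL, of k]
    have eq: "(\<lambda>x. T (K n x)) - T = ((\<lambda>x. ?R (K n x)) - ?R) + (op_head k (\<lambda>x. T (K n x)) - op_head k T)"
      by (simp add: op_head_def fun_eq_iff)
    have "N ((\<lambda>x. T (K n x)) - T) \<le> N ((\<lambda>x. ?R (K n x)) - ?R) + N (op_head k (\<lambda>x. T (K n x)) - op_head k T)"
      unfolding eq
      by (rule L_plus(2)[OF op.E_diff[OF L_compose(1)[OF RL K] RL]
            op.E_diff[OF op_head_L[OF L_compose(1)[OF TL K]] op_head_L[OF TL]]])
    moreover have "N ((\<lambda>x. ?R (K n x)) - ?R) \<le> N (\<lambda>x. ?R (K n x)) + N ?R"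
      by (rule op_norm_minus(1)[OF L_compose(1)[OF RL K] RL])
    moreover have "N (\<lambda>x. ?R (K n x)) \<le> N ?R * M"
      using L_compose(2)[OF RL K, of n] mult_left_mono[OF M[of n] op_norm_nonneg[OF RL]] by linarith
    moreover have "N ?R * (M + 1) = N ?R * M + N ?R" by (simp add: distrib_left)
    ultimately show ?thesis using k n0[OF that] by linarith
  qed
  then show "\<exists>n0. \<forall>n\<ge>n0. norm (N ((\<lambda>x. T (K n x)) - T) - 0) < e"
    using op_norm_nonneg[OF op.E_diff[OF L_compose(1)[OF TL K] TL]] by auto
qed

text \<open>The parameters are chosen in the order \<open>l\<close>, \<open>k\<close>,
  \<open>m\<close>: the truncation index \<open>k\<close> depends on the compact operator
  \<open>S\<close> composed with \<open>K l\<close>, and \<open>m\<close> must then make the first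
  \<open>k\<close> coordinates of the other summand small.\<close>

lemma eventually_mixed_norm_le:
  assumes S: "S \<in> L" "N S \<le> 1" and T: "T \<in> L" "N T \<le> 1" and c: "1 < c"
    and K: "\<And>n. K n \<in> compact_ops scale scale"
    and b: "\<And>f. f \<in> dual scale \<Longrightarrow> (\<lambda>n. onorm (\<lambda>x. f (K n x) - f x)) \<longlonglongrightarrow> 0"
    and est: "\<And>C. 1 < C \<Longrightarrow> \<forall>\<^sub>F l in sequentially. \<forall>\<^sub>F m in sequentially.
      \<forall>x. norm x \<le> 1 \<longrightarrow> norm (K l x) powr p + norm (x - K m x) powr p \<le> C"
  shows "\<forall>\<^sub>F l in sequentially. \<forall>\<^sub>F m in sequentially.
    N ((\<lambda>x. S (K l x)) + (T - (\<lambda>x. T (K m x)))) \<le> c"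
proof -
  have Klin: "K n \<in> linear_ops scale scale" for n using K[of n] by (simp add: compact_ops_def)
  \<comment> \<open>The glued main part contributes \<open>(1 + c) / 2\<close> and two truncation
    errors contribute \<open>e\<close> each, which adds up to \<open>c\<close>.\<close>
  define e where "e = (c - 1) / 4"
  have e: "0 < e" using c by (simp add: e_def)
  have "1 < ((1 + c) / 2) powr p" using c p by simp
  from est[OF this] show ?thesis
  proof (rule eventually_mono)
    fix l assume l: "\<forall>\<^sub>F m in sequentially. \<forall>x. norm x \<le> 1 \<longrightarrow>
      norm (K l x) powr p + norm (x - K m x) powr p \<le> ((1 + c) / 2) powr p"
    define S' where "S' = (\<lambda>x. S (K l x))"
    have S': "S' \<in> lp_compact_ops scale p"
      unfolding S'_def by (rule compact_compose[OF S(1) K])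
    note S'L = compact_L[OF S']
    obtain k where k: "N (S' - op_head k S') < e"
      using order_tendstoD(2)[OF compact_imp_tail[OF S'] e] by (auto simp: eventually_sequentially)
    have "\<forall>\<^sub>F m in sequentially. N (op_head k (\<lambda>x. T (K m x)) - op_head k T) < e"
      by (rule order_tendstoD(2)[OF op_head_tendsto_0[OF T(1) Klin b] e])
    with l show "\<forall>\<^sub>F m in sequentially. N ((\<lambda>x. S (K l x)) + (T - (\<lambda>x. T (K m x)))) \<le> c"
    proof eventually_elim
      fix m
      assume m: "\<forall>x. norm x \<le> 1 \<longrightarrow> norm (K l x) powr p + norm (x - K m x) powr p \<le> ((1 + c) / 2) powr p"
        and head: "N (op_head k (\<lambda>x. T (K m x)) - op_head k T) < e"
      define R where "R = T - (\<lambda>x. T (K m x))"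
      have RL: "R \<in> L" unfolding R_def by (rule op.E_diff[OF T(1) L_compose(1)[OF T(1) Klin]])
      have hR: "N (op_head k R) < e"
        using head op_norm_minus(2)[OF op_head_L[OF T(1)] op_head_L[OF L_compose(1)[OF T(1) Klin]], of k k m]
        by (simp add: R_def op_head_minus)
      have "N (S' + R) \<le> c"
      proof (rule op_norm_le_ball[OF L_plus(1)[OF S'L RL]])
        fix x :: 'a assume x: "norm x \<le> 1"
        \<comment> \<open>\<open>?g\<close> keeps the first \<open>k\<close> coordinates of
          \<open>S' x\<close> and the remaining ones of \<open>R x\<close>; \<open>?h\<close>
          collects what was cut off, the tail of \<open>S' x\<close> and the head of
          \<open>R x\<close>.\<close>
        let ?g = "lp_head k (S' x) + (R x - lp_head k (R x))"
        let ?h = "(S' - op_head k S') x + op_head k R x"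
        have eq: "(S' + R) x = ?g + ?h" by (simp add: op_head_def)
        have glp: "?g \<in> lp p" by (rule lp_glue(1)[OF p_pos L_lp[OF S'L] L_lp[OF RL]])
        have "lp_norm p (S' x) \<le> norm (K l x)"
          using op_norm_bound[OF S(1), of "K l x"] mult_right_mono[OF S(2), of "norm (K l x)"]
          by (simp add: S'_def)
        moreover have "lp_norm p (R x) \<le> norm (x - K m x)"
          using op_norm_bound[OF T(1), of "x - K m x"] mult_right_mono[OF T(2), of "norm (x - K m x)"]
          by (simp add: R_def L_diff[OF T(1)])
        ultimately have "lp_norm p (S' x) powr p + lp_norm p (R x) powr p
            \<le> norm (K l x) powr p + norm (x - K m x) powr p"
          using p by (intro add_mono powr_mono2) auto
        also have "\<dots> \<le> ((1 + c) / 2) powr p" using m x by blast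
        finally have "(lp_norm p (S' x) powr p + lp_norm p (R x) powr p) powr (1 / p)
            \<le> (((1 + c) / 2) powr p) powr (1 / p)"
          using p by (intro powr_mono2) auto
        also have "\<dots> = (1 + c) / 2" using p c by (simp add: powr_powr)
        finally have g: "lp_norm p ?g \<le> (1 + c) / 2"
          using lp_glue(2)[OF p_pos L_lp[OF S'L] L_lp[OF RL], of k x x] by linarith
        have "lp_norm p ?h \<le> lp_norm p ((S' - op_head k S') x) + lp_norm p (op_head k R x)"
          by (intro lp_add'(2) L_lp op_tail_L op_head_L S'L RL)
        also have "\<dots> \<le> e + e"
          using op_norm_ball[OF op_tail_L[OF S'L] x, of k] op_norm_ball[OF op_head_L[OF RL] x, of k] k hR
          by linarith
        finally have h: "lp_norm p ?h \<le> 2 * e" by simp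
        have "lp_norm p (?g + ?h) \<le> lp_norm p ?g + lp_norm p ?h"
          by (intro lp_add'(2) glp lp_add'(1) L_lp op_tail_L op_head_L S'L RL)
        also have "\<dots> \<le> (1 + c) / 2 + 2 * e" using g h by (rule add_mono)
        also have "\<dots> = c" by (simp add: e_def field_simps)
        finally show "lp_norm p ((S' + R) x) \<le> c" unfolding eq .
      qed (use c in simp)
      then show "N ((\<lambda>x. S (K l x)) + (T - (\<lambda>x. T (K m x)))) \<le> c"
        by (simp add: S'_def R_def)
    qed
  qed
qed

end

theorem theorem2p1:
  fixes scale :: "'k::{real_normed_field,euclidean_space} \<Rightarrow> 'a::banach \<Rightarrow> 'a"
    and K :: "nat \<Rightarrow> 'a \<Rightarrow> 'a"
    and p :: real
  assumes p: "1 < p"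
    and X: "banach_over scale"
    and K: "\<And>n. K n \<in> compact_ops scale scale"
    and a: "\<And>x. (\<lambda>n. K n x) \<longlonglongrightarrow> x"
    and b: "\<And>f. f \<in> dual scale \<Longrightarrow> (\<lambda>n. onorm (\<lambda>x. f (K n x) - f x)) \<longlonglongrightarrow> 0"
    and c: "(\<lambda>n. onorm (\<lambda>x. x - 2 *\<^sub>R K n x)) \<longlonglongrightarrow> 1"
    and basic: "\<And>x xs. weakly_null scale xs \<Longrightarrow>
      limsup (\<lambda>n. ereal ((norm x powr p + norm (xs n) powr p) powr (1 / p)))
      \<le> limsup (\<lambda>n. ereal (((norm (x + xs n) powr p + norm (x - xs n) powr p) / 2) powr (1 / p)))"
  shows "M_ideal_on (scale_fun (scale_fun (*))) (lp_op_norm p)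
    (lp_linear_ops scale p) (lp_compact_ops scale p)"
proof -
  interpret X: lp_operators scale p
    using X p by (simp add: lp_operators_def lp_operators_axioms_def)
  have Klin: "K n \<in> linear_ops scale scale" for n using K[of n] by (simp add: compact_ops_def)
  then have bl: "bounded_linear (K n)" for n by (simp add: linear_ops_def)
  have bl2: "bounded_linear (\<lambda>x. x - 2 *\<^sub>R K n x)" for n
    by (intro bounded_linear_sub bounded_linear_ident bounded_linear_compose[OF bounded_linear_scaleR_right bl])
  \<comment> \<open>The norms of \<open>Id - 2 K n\<close> converge and hence are bounded; halving
    the difference from \<open>Id\<close> bounds all \<open>K n\<close> uniformly.\<close>
  obtain M where M: "\<And>n. onorm (\<lambda>x. x - 2 *\<^sub>R K n x) \<le> M"
    using convergent_imp_Bseq[OF convergentI[OF c]] unfolding Bseq_def real_norm_def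
    by (meson abs_le_D1)
  have onorm_K: "onorm (K n) \<le> (1 + M) / 2" for n
  proof (rule onorm_bound)
    show "0 \<le> (1 + M) / 2" using M[of n] onorm_pos_le[OF bl2, of n] by simp
    fix x
    have "norm (2 *\<^sub>R K n x) \<le> norm x + norm (x - 2 *\<^sub>R K n x)"
      using norm_triangle_ineq4[of x "x - 2 *\<^sub>R K n x"] by simp
    moreover have "norm (x - 2 *\<^sub>R K n x) \<le> M * norm x"
      using onorm[OF bl2[of n], of x] mult_right_mono[OF M[of n], of "norm x"] by simp
    ultimately show "norm (K n x) \<le> (1 + M) / 2 * norm x" by (simp add: field_simps)
  qed
  show ?thesis
  \<comment> \<open>Right composition with \<open>K n\<close> sends every operator to a compact one,
    and its norm is at most the uniform bound for \<open>onorm (K n)\<close>.\<close>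
  proof (rule X.op.M_ideal_onI[where A = "\<lambda>n T x. T (K n x)" and C = "(1 + M) / 2"])
    show "closed_subspace_on (scale_fun (scale_fun (*))) (lp_op_norm p)
        (lp_linear_ops scale p) (lp_compact_ops scale p)"
      by (rule X.closed_subspace_compact)
    fix S T :: "'a \<Rightarrow> nat \<Rightarrow> 'k" and n
    show "(\<lambda>x. (S + T) (K n x)) = (\<lambda>x. S (K n x)) + (\<lambda>x. T (K n x))"
      by (simp add: fun_eq_iff)
    show "(\<lambda>x. scale_fun (scale_fun (*)) c S (K n x)) = scale_fun (scale_fun (*)) c (\<lambda>x. S (K n x))" for c
      by (simp add: scale_fun_def)
    show "(\<lambda>n. lp_op_norm p ((\<lambda>x. S (K n x)) - S)) \<longlonglongrightarrow> 0" if "S \<in> lp_compact_ops scale p"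
      using that Klin b onorm_K by (rule X.compact_compose_tendsto)
    assume S: "S \<in> lp_linear_ops scale p"
    show "(\<lambda>x. S (K n x)) \<in> lp_compact_ops scale p"
      by (rule X.compact_compose[OF S K])
    show "lp_op_norm p (\<lambda>x. S (K n x)) \<le> (1 + M) / 2 * lp_op_norm p S"
      using X.L_compose(2)[OF S Klin, of n] mult_left_mono[OF onorm_K[of n] X.op_norm_nonneg[OF S]]
      by (simp add: mult.commute)
    assume "T \<in> lp_linear_ops scale p" "lp_op_norm p S \<le> 1" "lp_op_norm p T \<le> 1"
    then show "\<forall>\<^sub>F l in sequentially. \<forall>\<^sub>F m in sequentially.
        lp_op_norm p ((\<lambda>x. S (K l x)) + (T - (\<lambda>x. T (K m x)))) \<le> d" if "1 < d" for d
      using S that K b basic_inequality_uniform[OF p K a b c basic]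
      by (intro X.eventually_mixed_norm_le)
  qed
qed

end
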